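(* Let $S_1,\ldots,S_n$ be Polish spaces, $\mu$ a Borel probability measure on $S=\prod_{i=1}^nS_i$, $\mathcal{I}$ a collection of subsets of $\{1,\ldots,n\}$, and $d\in\mathbb{N}$. Assume $\mu$ satisfies $\mathrm{LSI}_{(\partial,\mathcal{I})}(\sigma^2)$ for some $\sigma^2>0$. Let $f\in L^\infty(\mu)$ satisfy \[ \|\mathfrak{h}^{(k)}f\|_2\le\min(1,\sigma^{d-k})\quad\text{for all }k=1,\ldots,d-1,\qquad \|\mathfrak{h}^{(d)}f\|_\infty\le1 . \] Then there exists a constant $c>0$ such that $\mathbb{E}_\mu\exp\big(c|f-\mathbb{E}_\mu f|^{2/d}\big)\le2$; a possible choice is $c=1/(12\sigma^2e)$.
   Context: For $I\subset\{1,\ldots,n\}$ and $x\in S$ write $x_I=(x_i)_{i\in I}$, $\overline{x_I}=(x_i)_{i\notin I}$, $S_I=\prod_{i\in I}S_i$, and $(\overline{x_I},y_I)$ for the point of $S$ with coordinates $y_i$ ($i\in I$) and $x_i$ ($i\notin I$). Let $\overline{\mu_I}$ be the law of $\overline{x_I}$ under $\mu$, and $(m_{\overline{x_I}})$ a disintegration: a Markov kernel of probability measures on $S_I$ with $\int g\,d\mu=\int\int g(\overline{x_I},y_I)\,dm_{\overline{x_I}}(y_I)\,d\overline{\mu_I}(\overline{x_I})$ for $g\in L^1(\mu)$. For $I\in\mathcal{I}$: $\partial_If(x)=\big(\frac12\int(f(x)-f(\overline{x_I},y_I))^2dm_{\overline{x_I}}(y_I)\big)^{1/2}$ and $|\partial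 f|=(\sum_{I\in\mathcal{I}}(\partial_If)^2)^{1/2}$; $\mathfrak{h}_If(x)=\frac1{\sqrt2}\|f(\overline{x_I},y_I)-f(\overline{x_I},z_I)\|_{L^\infty(m_{\overline{x_I}}\otimes m_{\overline{x_I}}(y_I,z_I))}$. Higher order: $\mathfrak{h}_{I_1\ldots I_d}f=\mathfrak{h}_{I_1}(\mathfrak{h}_{I_2\ldots I_d}f)$, $\mathfrak{h}^{(d)}f(x)=(\mathfrak{h}_{I_1\ldots I_d}f(x))_{(I_1,\ldots,I_d)\in\mathcal{I}^d}$, and $|\mathfrak{h}^{(d)}f|$ its Euclidean norm. $\|g\|_p=(\mathbb{E}_\mu|g|^p)^{1/p}$, $\|\mathfrak{h}^{(d)}f\|_p=\||\mathfrak{h}^{(d)}f|\|_p$, with $p=\infty$ the $\mu$-essential supremum. $\mu$ satisfies $\mathrm{LSI}_{(\partial,\mathcal{I})}(\sigma^2)$ if $\mathrm{Ent}_\mu(f^2)\le2\sigma^2\mathbb{E}_\mu|\partial f|^2$ for all $f\in L^\infty(\mu)$, where $\mathrm{Ent}_\mu(g)=\mathbb{E}_\mu g\log g-\mathbb{E}_\mu g\log\mathbb{E}_\mu g$ for $g\ge0$. *)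

theory Defs
  imports "HOL-Analysis.Analysis" "HOL-Probability.Probability"
begin

definition Polish :: "'a topology \<Rightarrow> bool" where
  "Polish X \<longleftrightarrow> completely_metrizable_space X \<and> separable_space X"

definition borel_of :: "'a topology \<Rightarrow> 'a measure" where
  "borel_of X = sigma (topspace X) {U. openin X U}"

definition prodS :: "nat \<Rightarrow> (nat \<Rightarrow> 'a topology) \<Rightarrow> (nat \<Rightarrow> 'a) measure" where
  "prodS n X = PiM {..<n} (\<lambda>i. borel_of (X i))"

definition prodSI :: "nat set \<Rightarrow> (nat \<Rightarrow> 'a topology) \<Rightarrow> (nat \<Rightarrow> 'a) measure" where
  "prodSI I X = PiM I (\<lambda>i. borel_of (X i))"

definition mrg :: "nat set \<Rightarrow> (nat \<Rightarrow> 'a) \<Rightarrow> (nat \<Rightarrow> 'a) \<Rightarrow> (nat \<Rightarrow> 'a)" where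
  "mrg I x y = (\<lambda>i. if i \<in> I then y i else x i)"

text \<open>m is a disintegration of mu with respect to the coordinates in I:
  m I x is the kernel measure m_{bar x_I} on S_I (it depends on x only through bar x_I).\<close>
definition disintegration ::
  "nat \<Rightarrow> (nat \<Rightarrow> 'a topology) \<Rightarrow> (nat \<Rightarrow> 'a) measure \<Rightarrow> nat set
     \<Rightarrow> ((nat \<Rightarrow> 'a) \<Rightarrow> (nat \<Rightarrow> 'a) measure) \<Rightarrow> bool" where
  "disintegration n X \<mu> I k \<longleftrightarrow>
     k \<in> measurable (prodS n X) (subprob_algebra (prodSI I X)) \<and>
     (\<forall>x \<in> space (prodS n X). prob_space (k x) \<and> sets (k x) = sets (prodSI I X)) \<and>
     (\<forall>x \<in> space (prodS n X). \<forall>x' \<in> space (prodS n X).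
        (\<forall>i \<in> {..<n} - I. x i = x' i) \<longrightarrow> k x = k x') \<and>
     (\<forall>g::(nat \<Rightarrow> 'a) \<Rightarrow> real. integrable \<mu> g \<longrightarrow>
        (\<integral>x. g x \<partial>\<mu>) = (\<integral>x. (\<integral>y. g (mrg I x y) \<partial>(k x)) \<partial>\<mu>))"

definition Linf :: "'b measure \<Rightarrow> ('b \<Rightarrow> real) \<Rightarrow> bool" where
  "Linf \<mu> f \<longleftrightarrow> f \<in> borel_measurable \<mu> \<and> (\<exists>C. AE x in \<mu>. \<bar>f x\<bar> \<le> C)"

definition partI :: "((nat \<Rightarrow> 'a) \<Rightarrow> (nat \<Rightarrow> 'a) measure) \<Rightarrow> nat set
     \<Rightarrow> ((nat \<Rightarrow> 'a) \<Rightarrow> real) \<Rightarrow> (nat \<Rightarrow> 'a) \<Rightarrow> real" where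
  "partI k I f x = sqrt ((1/2) * (\<integral>y. (f x - f (mrg I x y))^2 \<partial>(k x)))"

definition grad_norm :: "(nat set \<Rightarrow> (nat \<Rightarrow> 'a) \<Rightarrow> (nat \<Rightarrow> 'a) measure) \<Rightarrow> nat set set
     \<Rightarrow> ((nat \<Rightarrow> 'a) \<Rightarrow> real) \<Rightarrow> (nat \<Rightarrow> 'a) \<Rightarrow> real" where
  "grad_norm m \<I> f x = sqrt (\<Sum>I\<in>\<I>. (partI (m I) I f x)^2)"

text \<open>Entropy Ent_mu(g) = E g log g - E g log E g (with 0 log 0 = 0).\<close>
definition Ent :: "'b measure \<Rightarrow> ('b \<Rightarrow> real) \<Rightarrow> real" where
  "Ent \<mu> g = (\<integral>x. g x * ln (g x) \<partial>\<mu>) - (\<integral>x. g x \<partial>\<mu>) * ln (\<integral>x. g x \<partial>\<mu>)"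

definition LSI :: "(nat \<Rightarrow> 'a) measure \<Rightarrow> (nat set \<Rightarrow> (nat \<Rightarrow> 'a) \<Rightarrow> (nat \<Rightarrow> 'a) measure)
     \<Rightarrow> nat set set \<Rightarrow> real \<Rightarrow> bool" where
  "LSI \<mu> m \<I> sigma2 \<longleftrightarrow>
     (\<forall>f. Linf \<mu> f \<longrightarrow>
        Ent \<mu> (\<lambda>x. (f x)^2) \<le> 2 * sigma2 * (\<integral>x. (grad_norm m \<I> f x)^2 \<partial>\<mu>))"

text \<open>h_I f (x) = 2^{-1/2} || f(bar x_I, y_I) - f(bar x_I, z_I) ||_{L^infinity(m \<otimes> m)}.
  (The essential supremum is finite mu-a.e. for f in L^infinity; real_of_ereal is only a
  total-function device on the remaining null set.)\<close>
definition hI :: "((nat \<Rightarrow> 'a) \<Rightarrow> (nat \<Rightarrow> 'a) measure) \<Rightarrow> nat set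
     \<Rightarrow> ((nat \<Rightarrow> 'a) \<Rightarrow> real) \<Rightarrow> (nat \<Rightarrow> 'a) \<Rightarrow> real" where
  "hI k I f x = real_of_ereal (esssup (k x \<Otimes>\<^sub>M k x)
        (\<lambda>(y, z). ereal \<bar>f (mrg I x y) - f (mrg I x z)\<bar>)) / sqrt 2"

fun hseq :: "(nat set \<Rightarrow> (nat \<Rightarrow> 'a) \<Rightarrow> (nat \<Rightarrow> 'a) measure) \<Rightarrow> nat set list
     \<Rightarrow> ((nat \<Rightarrow> 'a) \<Rightarrow> real) \<Rightarrow> (nat \<Rightarrow> 'a) \<Rightarrow> real" where
  "hseq m [] f = f"
| "hseq m (I # Is) f = hI (m I) I (hseq m Is f)"

definition hnorm :: "(nat set \<Rightarrow> (nat \<Rightarrow> 'a) \<Rightarrow> (nat \<Rightarrow> 'a) measure) \<Rightarrow> nat set set \<Rightarrow> nat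
     \<Rightarrow> ((nat \<Rightarrow> 'a) \<Rightarrow> real) \<Rightarrow> (nat \<Rightarrow> 'a) \<Rightarrow> real" where
  "hnorm m \<I> d f x = sqrt (\<Sum>Is\<in>{Is. set Is \<subseteq> \<I> \<and> length Is = d}. (hseq m Is f x)^2)"

end

(* Applied to u = |g|^(q/2), the logarithmic Sobolev inequality bounds Ent(|g|^q) by
   sigma^2 q^2 E |g|^(q-2) |h g|^2. This is usually read as a differential inequality in q for
   ||g||_q^2. Here integer exponents suffice: Ent(|g|^q) dominates
   E|g|^q (pq/2) log(||g||_q^2 / ||g||_p^2) for q = p + 1, whence
     ||g||_q^2 <= ||g||_p^2 + 2 sigma^2 (q/p) ||h g||_q^2.
   For p >= 2 the factor q/p is at most 3/2, so summing gives
     ||g||_Q^2 <= ||g||_2^2 + 3 sigma^2 (Q - 2) ||h g||_Q^2,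
   and p = 1, applied to f plus a large constant, gives Var f <= 4 sigma^2 E |h f|^2.
   Since |h |h^(j) f|| <= |h^(j+1) f| by the triangle inequality in Euclidean norm, iterating
   d times yields ||f - E f||_(2k)^2 <= (6 k sigma^2)^d, that is, by Jensen's inequality,
   E |f - E f|^(2k/d) <= (6 k sigma^2)^k. As k^k <= k! e^k, the k-th term of the exponential series
   with c = 1/(12 sigma^2 e) has expectation at most 2^-k. *)
theory Submission
  imports Defs
begin

subsection \<open>Essentially bounded functions\<close>

text \<open>Boundedness is only known almost everywhere, while \<open>hI\<close> and
  \<open>partI\<close> look at single fibres. The bridge is one fact: resampling the coordinates in
  \<open>I\<close> from the kernel preserves \<mu>. Hence null sets of \<mu> are null in almost
  every fibre, and the pair (x, resampled x) in \<open>partI\<close> can be replaced by two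
  independent points of a common fibre, the pair that \<open>hI\<close> measures. As
  \<open>hI\<close> is constant along fibres, its square and the weight |g|^(q-2) recombine into a
  single integral over \<mu>. Origin of the factor q^2: differences of q/2-th powers are controlled
  by the derivative at the larger value, and replacing the maximum by the sum of both values makes
  the estimate separate in the two points, at the price of a factor 2. Origin of 6 = 3 * 2: one step
  of the iteration multiplies by 1 + 3(Q-2) = 3Q-5, the variance step replaces the 1 by 4, and both
  are absorbed into 3Q; then Q = 2k.\<close>

lemma LinfI: "f \<in> borel_measurable M \<Longrightarrow> AE x in M. \<bar>f x\<bar> \<le> C \<Longrightarrow> Linf M f"
  by (auto simp: Linf_def)

lemma LinfE:
  assumes "Linf M f"
  obtains C where "C \<ge> 0" "AE x in M. \<bar>f x\<bar> \<le> C"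
proof -
  obtain C where C: "AE x in M. \<bar>f x\<bar> \<le> C"
    using assms by (auto simp: Linf_def)
  have "AE x in M. \<bar>f x\<bar> \<le> max C 0"
    using C by eventually_elim auto
  then show ?thesis using that[of "max C 0"] by simp
qed

lemma Linf_measurable [measurable_dest]: "Linf M f \<Longrightarrow> f \<in> borel_measurable M"
  by (simp add: Linf_def)

lemma Linf_mono:
  assumes "Linf M g" "f \<in> borel_measurable M" "AE x in M. \<bar>f x\<bar> \<le> \<bar>g x\<bar>"
  shows "Linf M f"
proof -
  obtain C where "AE x in M. \<bar>g x\<bar> \<le> C" using assms(1) by (rule LinfE)
  then have "AE x in M. \<bar>f x\<bar> \<le> C" using assms(3) by eventually_elim auto
  with assms(2) show ?thesis by (rule LinfI)
qed

lemma Linf_const [simp, intro]: "Linf M (\<lambda>_. c)"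
  by (rule LinfI[of _ _ "\<bar>c\<bar>"]) auto

lemma Linf_add [intro]:
  assumes "Linf M f" "Linf M g"
  shows "Linf M (\<lambda>x. f x + g x)"
proof -
  obtain C where "AE x in M. \<bar>f x\<bar> \<le> C" using assms(1) by (rule LinfE)
  moreover obtain D where "AE x in M. \<bar>g x\<bar> \<le> D" using assms(2) by (rule LinfE)
  ultimately have "AE x in M. \<bar>f x + g x\<bar> \<le> C + D" by eventually_elim auto
  moreover have "(\<lambda>x. f x + g x) \<in> borel_measurable M" using assms by (auto simp: Linf_def)
  ultimately show ?thesis by (auto intro: LinfI)
qed

lemma Linf_mult [intro]:
  assumes "Linf M f" "Linf M g"
  shows "Linf M (\<lambda>x. f x * g x)"
proof -
  obtain C where C: "C \<ge> 0" "AE x in M. \<bar>f x\<bar> \<le> C" using assms(1) by (rule LinfE)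
  obtain D where D: "AE x in M. \<bar>g x\<bar> \<le> D" using assms(2) by (rule LinfE)
  have "AE x in M. \<bar>f x * g x\<bar> \<le> C * D"
    using C(2) D by eventually_elim (use C(1) in \<open>auto simp: abs_mult intro!: mult_mono\<close>)
  moreover have "(\<lambda>x. f x * g x) \<in> borel_measurable M" using assms by (auto simp: Linf_def)
  ultimately show ?thesis by (auto intro: LinfI)
qed

lemma Linf_abs [intro]: "Linf M f \<Longrightarrow> Linf M (\<lambda>x. \<bar>f x\<bar>)"
  by (rule Linf_mono[of M f]) (auto simp: Linf_def)

lemma Linf_diff [intro]: "Linf M f \<Longrightarrow> Linf M g \<Longrightarrow> Linf M (\<lambda>x. f x - g x)"
  using Linf_add[of M f "\<lambda>x. -1 * g x"] Linf_mult[of M "\<lambda>_. -1" g] by auto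

lemma Linf_power [intro]: "Linf M f \<Longrightarrow> Linf M (\<lambda>x. f x ^ n)"
  by (induction n) auto

lemma Linf_divide [intro]: "Linf M f \<Longrightarrow> Linf M (\<lambda>x. f x / c)"
  using Linf_mult[of M f "\<lambda>_. inverse c"] by (auto simp: divide_inverse)

lemma Linf_sum [intro]: "(\<And>i. i \<in> A \<Longrightarrow> Linf M (f i)) \<Longrightarrow> Linf M (\<lambda>x. \<Sum>i\<in>A. f i x)"
  by (induction A rule: infinite_finite_induct) auto

lemma Linf_powr:
  assumes "Linf M f" "t \<ge> 0"
  shows "Linf M (\<lambda>x. \<bar>f x\<bar> powr t)"
proof -
  obtain C where C: "AE x in M. \<bar>f x\<bar> \<le> C" using assms(1) by (rule LinfE)
  have "AE x in M. \<bar>\<bar>f x\<bar> powr t\<bar> \<le> C powr t"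
    using C by eventually_elim (use assms(2) in \<open>auto intro!: powr_mono2\<close>)
  moreover have "(\<lambda>x. \<bar>f x\<bar> powr t) \<in> borel_measurable M" using assms by (auto simp: Linf_def)
  ultimately show ?thesis by (intro LinfI)
qed

lemma (in prob_space) Linf_integrable [intro]:
  assumes "Linf M f"
  shows "integrable M f"
  using assms by (rule LinfE) (rule integrable_const_bound, auto intro: Linf_measurable assms)

text \<open>Keeps the entropy integrand essentially bounded, hence integrable. The bound near 0 is
  ln t \<le> t - 1 at t = 1/w.\<close>

lemma abs_mult_ln_le:
  fixes w :: real
  assumes "w \<ge> 0"
  shows "\<bar>w * ln w\<bar> \<le> w\<^sup>2 + 1"
proof (cases "w = 0")
  case False
  with assms have w: "w > 0" by simp
  have "ln w \<le> w" using ln_le_minus_one[OF w] by simp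
  then have 1: "w * ln w \<le> w * w" using w by simp
  have "- ln w \<le> 1/w - 1" using ln_le_minus_one[of "1/w"] w by (simp add: ln_div)
  then have "w * (- ln w) \<le> w * (1/w - 1)" using w by (intro mult_left_mono) auto
  also have "\<dots> = 1 - w" using w by (simp add: right_diff_distrib)
  finally have 2: "- (w * ln w) \<le> 1 - w" by simp
  have "0 \<le> w * w" by simp
  then show ?thesis using 1 2 w unfolding power2_eq_square by (intro abs_leI) linarith+
qed auto

subsection \<open>Moment inequalities\<close>

text \<open>Hoelder's inequality with exponents 1/\<theta> and 1/(1-\<theta>): normalise both
  functions to integral one and integrate Young's inequality. If one integral vanishes, so does that
  function almost everywhere.\<close>

lemma (in prob_space) integral_powr_mult_le:
  assumes u: "Linf M u" "\<And>x. u x \<ge> 0" and v: "Linf M v" "\<And>x. v x \<ge> 0"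
    and \<theta>: "0 < \<theta>" "\<theta> < 1"
  shows "(\<integral>x. u x powr \<theta> * v x powr (1 - \<theta>) \<partial>M) \<le> (\<integral>x. u x \<partial>M) powr \<theta> * (\<integral>x. v x \<partial>M) powr (1 - \<theta>)"
proof (cases "(\<integral>x. u x \<partial>M) = 0 \<or> (\<integral>x. v x \<partial>M) = 0")
  case True
  then have "(AE x in M. u x = 0) \<or> (AE x in M. v x = 0)"
    using integral_nonneg_eq_0_iff_AE[of M u] integral_nonneg_eq_0_iff_AE[of M v] u v by auto
  then have "AE x in M. u x powr \<theta> * v x powr (1 - \<theta>) = 0" by auto
  then show ?thesis by (simp add: integral_eq_zero_AE)
next
  case False
  define U V where "U = (\<integral>x. u x \<partial>M)" and "V = (\<integral>x. v x \<partial>M)"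
  have "U \<ge> 0" "V \<ge> 0" unfolding U_def V_def using u v by (auto intro: integral_nonneg_AE)
  with False have pos: "U > 0" "V > 0" by (auto simp: U_def V_def)
  have pw: "u x powr \<theta> * v x powr (1 - \<theta>) \<le> U powr \<theta> * V powr (1 - \<theta>) * (\<theta> * (u x / U) + (1 - \<theta>) * (v x / V))" for x
  proof -
    have "(u x / U) powr \<theta> * (v x / V) powr (1 - \<theta>) \<le> \<theta> * (u x / U) + (1 - \<theta>) * (v x / V)"
    proof (cases "u x = 0 \<or> v x = 0")
      case True
      have "0 \<le> \<theta> * (u x / U) + (1 - \<theta>) * (v x / V)"
        using u v \<theta> pos by (intro add_nonneg_nonneg mult_nonneg_nonneg divide_nonneg_nonneg) auto
      then show ?thesis using True by auto
    next
      case False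
      then have "u x / U > 0" "v x / V > 0" using u(2)[of x] v(2)[of x] pos by auto
      then show ?thesis
        using Youngs_inequality_0[of \<theta> "1 - \<theta>" "u x / U" "v x / V"] \<theta> by auto
    qed
    then have "U powr \<theta> * V powr (1 - \<theta>) * ((u x / U) powr \<theta> * (v x / V) powr (1 - \<theta>))
       \<le> U powr \<theta> * V powr (1 - \<theta>) * (\<theta> * (u x / U) + (1 - \<theta>) * (v x / V))"
      by (intro mult_left_mono) auto
    then show ?thesis using pos u(2)[of x] v(2)[of x] by (simp add: powr_divide)
  qed
  have Lpow: "Linf M (\<lambda>x. u x powr \<theta> * v x powr (1 - \<theta>))"
    using Linf_powr[OF u(1), of \<theta>] Linf_powr[OF v(1), of "1-\<theta>"] u v \<theta> by auto
  have "(\<integral>x. u x powr \<theta> * v x powr (1 - \<theta>) \<partial>M)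
      \<le> (\<integral>x. U powr \<theta> * V powr (1 - \<theta>) * (\<theta> * (u x / U) + (1 - \<theta>) * (v x / V)) \<partial>M)"
    by (intro integral_mono Linf_integrable Lpow pw Linf_add Linf_mult[OF Linf_const] Linf_divide u v)
  also have "\<dots> = U powr \<theta> * V powr (1 - \<theta>) * (\<theta> * (U / U) + (1 - \<theta>) * (V / V))"
    unfolding U_def V_def using u v by (simp add: Linf_integrable)
  finally show ?thesis using pos by (simp add: U_def V_def)
qed

lemma (in prob_space) integral_powr_le:
  assumes u: "Linf M u" "\<And>x. u x \<ge> 0" and \<theta>: "0 < \<theta>" "\<theta> \<le> 1"
  shows "(\<integral>x. u x powr \<theta> \<partial>M) \<le> (\<integral>x. u x \<partial>M) powr \<theta>"
proof (cases "\<theta> = 1")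
  case True
  have "0 \<le> (\<integral>x. u x \<partial>M)" using u by (auto intro: integral_nonneg_AE)
  with True show ?thesis using u by simp
next
  case False
  then show ?thesis
    using integral_powr_mult_le[OF u, of "\<lambda>_. 1" \<theta>] \<theta> prob_space by simp
qed

text \<open>The squared L^q norm rather than the norm, because the moment recursion is linear in
  squares.\<close>

definition Lq_norm_sq :: "'b measure \<Rightarrow> nat \<Rightarrow> ('b \<Rightarrow> real) \<Rightarrow> real" where
  "Lq_norm_sq M q u = (\<integral>x. \<bar>u x\<bar> ^ q \<partial>M) powr (2 / real q)"

lemma Lq_norm_sq_nonneg [simp]: "Lq_norm_sq M q u \<ge> 0"
  by (simp add: Lq_norm_sq_def)

lemma Lq_norm_sq_2: "Lq_norm_sq M 2 u = (\<integral>x. (u x)\<^sup>2 \<partial>M)"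
  by (simp add: Lq_norm_sq_def)

text \<open>Positive exponents matter: \<open>0 ^ 0 = 1\<close> but
  \<open>0 powr 0 = 0\<close>.\<close>

lemma power_eq_powr_fraction:
  fixes a :: real
  assumes "a \<ge> 0" "p > 0" "q > 0"
  shows "a ^ p = (a ^ q) powr (real p / real q)"
  using assms by (cases "a = 0") (auto simp: powr_realpow[symmetric] powr_powr zero_power)

lemma (in prob_space) Lq_norm_sq_mono_exponent:
  assumes u: "Linf M u" and pq: "0 < p" "p \<le> q"
  shows "Lq_norm_sq M p u \<le> Lq_norm_sq M q u"
proof -
  have "(\<integral>x. \<bar>u x\<bar> ^ p \<partial>M) = (\<integral>x. (\<bar>u x\<bar> ^ q) powr (real p / real q) \<partial>M)"
    using pq by (intro Bochner_Integration.integral_cong power_eq_powr_fraction) auto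
  also have "\<dots> \<le> (\<integral>x. \<bar>u x\<bar> ^ q \<partial>M) powr (real p / real q)"
    using pq u by (intro integral_powr_le) auto
  finally have "(\<integral>x. \<bar>u x\<bar> ^ p \<partial>M) powr (2 / p) \<le> ((\<integral>x. \<bar>u x\<bar> ^ q \<partial>M) powr (real p / real q)) powr (2 / p)"
    using pq by (intro powr_mono2) auto
  then show ?thesis unfolding Lq_norm_sq_def using pq by (simp add: powr_powr)
qed

lemma (in prob_space) Lq_norm_sq_mono:
  assumes "Linf M u" "Linf M v" "AE x in M. \<bar>u x\<bar> \<le> \<bar>v x\<bar>"
  shows "Lq_norm_sq M q u \<le> Lq_norm_sq M q v"
proof -
  have "(\<integral>x. \<bar>u x\<bar> ^ q \<partial>M) \<le> (\<integral>x. \<bar>v x\<bar> ^ q \<partial>M)"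
  proof (rule integral_mono_AE)
    show "AE x in M. \<bar>u x\<bar> ^ q \<le> \<bar>v x\<bar> ^ q"
      using assms(3) by eventually_elim (auto intro: power_mono)
  qed (intro Linf_integrable Linf_power Linf_abs assms)+
  then show ?thesis unfolding Lq_norm_sq_def by (intro powr_mono2) auto
qed

text \<open>Hoelder with exponents q/(q-2) and q/2. The factor W^(1-2/q) is written as W divided by
  the squared norm, so that W later cancels against the entropy bound.\<close>

lemma (in prob_space) integral_power_mult_le:
  assumes g: "Linf M g" and h: "Linf M h" and q: "q \<ge> 2"
    and W: "(\<integral>x. \<bar>g x\<bar> ^ q \<partial>M) > 0"
  shows "(\<integral>x. \<bar>g x\<bar> ^ (q - 2) * (h x)\<^sup>2 \<partial>M) \<le> (\<integral>x. \<bar>g x\<bar> ^ q \<partial>M) / Lq_norm_sq M q g * Lq_norm_sq M q h"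
proof -
  let ?W = "\<integral>x. \<bar>g x\<bar> ^ q \<partial>M"
  have eq: "?W / Lq_norm_sq M q g = ?W powr (1 - 2/q)"
    unfolding Lq_norm_sq_def using W q by (simp add: powr_diff)
  show ?thesis
  proof (cases "q = 2")
    \<comment> \<open>Here the weight is \<open>\<bar>g x\<bar> ^ 0 = 1\<close>, which is not a real
      power of |g|^q where g vanishes.\<close>
    case True
    then show ?thesis using eq W by (simp add: Lq_norm_sq_2)
  next
    case False
    then have q2: "q > 2" using q by simp
    have th: "1 - 2 / real q = real (q - 2) / real q" using q2 by (simp add: field_simps of_nat_diff)
    have "\<bar>g x\<bar> ^ (q - 2) * (h x)\<^sup>2 = (\<bar>g x\<bar> ^ q) powr (1 - 2/q) * (\<bar>h x\<bar> ^ q) powr (1 - (1 - 2/q))" for x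
    proof -
      have "\<bar>g x\<bar> ^ (q - 2) = (\<bar>g x\<bar> ^ q) powr (1 - 2/q)"
        unfolding th using q2 by (intro power_eq_powr_fraction) auto
      moreover have "(h x)\<^sup>2 = (\<bar>h x\<bar> ^ q) powr (1 - (1 - 2/q))"
        using power_eq_powr_fraction[of "\<bar>h x\<bar>" 2 q] q2 by simp
      ultimately show ?thesis by (rule arg_cong2)
    qed
    moreover have "(\<integral>x. (\<bar>g x\<bar> ^ q) powr (1 - 2/q) * (\<bar>h x\<bar> ^ q) powr (1 - (1 - 2/q)) \<partial>M)
        \<le> ?W powr (1 - 2/q) * (\<integral>x. \<bar>h x\<bar> ^ q \<partial>M) powr (1 - (1 - 2/q))"
      by (intro integral_powr_mult_le Linf_power Linf_abs g h) (use q2 in auto)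
    ultimately show ?thesis unfolding eq Lq_norm_sq_def[of _ _ h] by simp
  qed
qed

text \<open>Mean value theorem for the power q/2. As q \<ge> 2, the derivative is increasing, so it
  is largest at the larger of a and b; the sum of both (q-2)-th powers dominates that term and is
  symmetric.\<close>

lemma powr_half_diff_squared_le:
  fixes a b :: real
  assumes "a \<ge> 0" "b \<ge> 0" "q \<ge> (2::nat)"
  shows "(a powr (q/2) - b powr (q/2))\<^sup>2 \<le> (real q)\<^sup>2 / 4 * (a - b)\<^sup>2 * (a ^ (q - 2) + b ^ (q - 2))"
proof -
  define t where "t = real q / 2"
  have t: "t \<ge> 1" using assms by (simp add: t_def)
  have *: "(a powr t - b powr t)\<^sup>2 \<le> t\<^sup>2 * (a - b)\<^sup>2 * a ^ (q - 2)" if "0 \<le> b" "b \<le> a" for a b :: real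
  proof (cases "b = a")
    case False
    then have a: "a > 0" "b < a" using that by auto
    have "a powr t - b powr t \<le> t * a powr (t - 1) * (a - b)"
    \<comment> \<open>The differentiation rule for \<open>powr\<close> requires a positive base, so
      the endpoint 0 is treated directly.\<close>
    proof (cases "b = 0")
      case True
      have "a powr t = a powr (t - 1) * a" using a by (simp add: powr_diff)
      then show ?thesis using True a t by simp
    next
      case False
      then have b: "b > 0" using that by simp
      have "\<exists>z>b. z < a \<and> a powr t - b powr t = (a - b) * (t * z powr (t - 1))"
        by (rule MVT2) (use a b in \<open>auto intro!: DERIV_powr derivative_eq_intros\<close>)
      then obtain z where z: "b < z" "z < a" "a powr t - b powr t = (a - b) * (t * z powr (t - 1))" by blast
      have "z powr (t - 1) \<le> a powr (t - 1)" using z b t by (intro powr_mono2) auto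
      then have "(a - b) * (t * z powr (t - 1)) \<le> (a - b) * (t * a powr (t - 1))"
        using a t by (intro mult_left_mono) auto
      then show ?thesis using z(3) by (simp add: mult_ac)
    qed
    moreover have "0 \<le> a powr t - b powr t" using that t powr_mono2[of t b a] by simp
    ultimately have "(a powr t - b powr t)\<^sup>2 \<le> (t * a powr (t - 1) * (a - b))\<^sup>2"
      by (intro power_mono)
    also have "(a powr (t - 1))\<^sup>2 = a ^ (q - 2)"
    proof -
      have "(a powr (t - 1))\<^sup>2 = a powr (real (q - 2))"
        using assms(3) by (simp add: power2_eq_square powr_add[symmetric] t_def of_nat_diff)
      then show ?thesis using a by (simp add: powr_realpow)
    qed
    then have "(t * a powr (t - 1) * (a - b))\<^sup>2 = t\<^sup>2 * (a - b)\<^sup>2 * a ^ (q - 2)"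
      by (simp add: power_mult_distrib mult_ac)
    finally show ?thesis .
  qed auto
  have t2: "t\<^sup>2 = (real q)\<^sup>2 / 4" by (simp add: t_def power2_eq_square)
  show ?thesis
  proof (cases "b \<le> a")
    case True
    have "t\<^sup>2 * (a - b)\<^sup>2 * a ^ (q - 2) \<le> t\<^sup>2 * (a - b)\<^sup>2 * (a ^ (q - 2) + b ^ (q - 2))"
      using assms by (intro mult_left_mono) auto
    with *[OF assms(2) True] show ?thesis unfolding t2[symmetric] t_def[symmetric] by linarith
  next
    case False
    have "t\<^sup>2 * (a - b)\<^sup>2 * b ^ (q - 2) \<le> t\<^sup>2 * (a - b)\<^sup>2 * (a ^ (q - 2) + b ^ (q - 2))"
      using assms by (intro mult_left_mono) auto
    moreover have "(b powr t - a powr t)\<^sup>2 \<le> t\<^sup>2 * (b - a)\<^sup>2 * b ^ (q - 2)"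
      using *[of a b] False assms(1) by linarith
    ultimately show ?thesis
      unfolding t2[symmetric] t_def[symmetric] power2_commute[of "b powr t" "a powr t"] power2_commute[of b a]
      by linarith
  qed
qed

text \<open>A derivative-free substitute for the formula relating the entropy to the derivative of
  \<open>q \<mapsto> \<parallel>g\<parallel>\<^sub>q\<^sup>2\<close>; it follows from \<open>ln t \<le> t - 1\<close> with \<open>t = \<bar>g\<bar>\<^sup>p W / (\<bar>g\<bar>\<^sup>q V)\<close>,
  where \<open>V\<close> and \<open>W\<close> are the moments of order \<open>p\<close> and \<open>q\<close>.\<close>

lemma (in prob_space) Ent_power_ge:
  assumes g: "Linf M g" and p: "p \<ge> 1" and q: "q = Suc p"
    and W: "(\<integral>x. \<bar>g x\<bar> ^ q \<partial>M) > 0"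
  shows "Lq_norm_sq M p g > 0"
    and "(\<integral>x. \<bar>g x\<bar> ^ q \<partial>M) * (real p * real q / 2) * ln (Lq_norm_sq M q g / Lq_norm_sq M p g)
      \<le> Ent M (\<lambda>x. \<bar>g x\<bar> ^ q)"
proof -
  define w v where "w = (\<lambda>x. \<bar>g x\<bar> ^ q)" and "v = (\<lambda>x. \<bar>g x\<bar> ^ p)"
  define W V where "W = (\<integral>x. w x \<partial>M)" and "V = (\<integral>x. v x \<partial>M)"
  have Wpos: "W > 0" using W by (simp add: W_def w_def)
  have Lw: "Linf M w" and Lv: "Linf M v" unfolding w_def v_def using g by auto
  have wnn: "w x \<ge> 0" and vnn: "v x \<ge> 0" for x by (auto simp: w_def v_def)
  have "V \<noteq> 0"
  proof
    assume "V = 0"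
    then have "AE x in M. v x = 0"
      unfolding V_def using integral_nonneg_eq_0_iff_AE[of M v] Lv vnn by auto
    then have "AE x in M. w x = 0" by eventually_elim (use p q in \<open>auto simp: v_def w_def\<close>)
    then have "W = 0" unfolding W_def by (simp add: integral_eq_zero_AE)
    then show False using Wpos by simp
  qed
  moreover have "V \<ge> 0" unfolding V_def using vnn by simp
  ultimately have Vpos: "V > 0" by simp
  then show "Lq_norm_sq M p g > 0" by (simp add: Lq_norm_sq_def V_def v_def)
  have Lwln: "Linf M (\<lambda>x. w x * ln (w x))"
  proof (rule Linf_mono)
    show "Linf M (\<lambda>x. (w x)\<^sup>2 + 1)" using Lw by auto
    show "(\<lambda>x. w x * ln (w x)) \<in> borel_measurable M" using Lw by (auto simp: Linf_def)
    show "AE x in M. \<bar>w x * ln (w x)\<bar> \<le> \<bar>(w x)\<^sup>2 + 1\<bar>"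
      using abs_mult_ln_le wnn by (intro AE_I2) (smt (verit) abs_mult_ln_le)
  qed
  have pw: "- (1 / q) * (w x * ln (w x)) + (ln W - ln V) * w x \<le> v x * W / V - w x" for x
  proof (cases "g x = 0")
    case True
    then show ?thesis using p q Wpos Vpos by (simp add: w_def v_def)
  next
    case False
    then have pos: "w x > 0" "v x > 0" by (auto simp: w_def v_def)
    have lnv: "ln (v x) = real p / real q * ln (w x)"
      using False p q by (simp add: w_def v_def ln_realpow del: power_Suc)
    have "ln (v x * W / (w x * V)) \<le> v x * W / (w x * V) - 1"
      using pos Wpos Vpos by (intro ln_le_minus_one) auto
    then have "w x * (ln (v x) + ln W - (ln (w x) + ln V)) \<le> w x * (v x * W / (w x * V) - 1)"
      using pos Wpos Vpos by (intro mult_left_mono) (auto simp: ln_mult ln_div)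
    also have "\<dots> = v x * W / V - w x" using pos Vpos by (simp add: field_simps)
    \<comment> \<open>The coefficient is p/q - 1 = -1/q because q = p + 1.\<close>
    also have "w x * (ln (v x) + ln W - (ln (w x) + ln V)) = - (1 / q) * (w x * ln (w x)) + (ln W - ln V) * w x"
      unfolding lnv q by (simp add: field_simps)
    finally show ?thesis .
  qed
  have "(\<integral>x. - (1 / q) * (w x * ln (w x)) + (ln W - ln V) * w x \<partial>M) \<le> (\<integral>x. v x * W / V - w x \<partial>M)"
  proof (intro integral_mono pw)
    show "integrable M (\<lambda>x. - (1 / q) * (w x * ln (w x)) + (ln W - ln V) * w x)"
      by (intro Linf_integrable Linf_add Linf_mult[OF Linf_const] Lwln Lw)
    show "integrable M (\<lambda>x. v x * W / V - w x)"
      using Lv Lw by (intro Linf_integrable Linf_diff Linf_divide Linf_mult Linf_const)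
  qed
  \<comment> \<open>The ratio W/V was chosen for this: v * W / V and w have the same
    integral.\<close>
  also have "\<dots> = 0"
    using Lv Lw Vpos by (simp add: Linf_integrable W_def[symmetric] V_def[symmetric])
  also have "(\<integral>x. - (1 / q) * (w x * ln (w x)) + (ln W - ln V) * w x \<partial>M)
    = - (1 / q) * (\<integral>x. w x * ln (w x) \<partial>M) + (ln W - ln V) * W"
    using Lwln Lw unfolding W_def
    by (subst Bochner_Integration.integral_add) (auto simp: Linf_integrable simp del: times_divide_eq_left)
  finally have "(ln W - ln V) * W \<le> (\<integral>x. w x * ln (w x) \<partial>M) / q" by simp
  then have A: "q * ((ln W - ln V) * W) \<le> (\<integral>x. w x * ln (w x) \<partial>M)"
    using q by (simp add: field_simps)
  have lnn: "ln (Lq_norm_sq M q g / Lq_norm_sq M p g) = 2 / q * ln W - 2 / p * ln V"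
    using Wpos Vpos by (simp add: Lq_norm_sq_def ln_div ln_powr W_def V_def w_def v_def)
  have B: "W * (real p * real q / 2) * ln (Lq_norm_sq M q g / Lq_norm_sq M p g) = q * ((ln W - ln V) * W) - W * ln W"
  proof -
    have "real p * real q / 2 * (2 / q * x - 2 / p * y) = p * x - q * y" for x y :: real
      using p q by (simp add: right_diff_distrib del: of_nat_Suc)
    then have "W * (real p * real q / 2) * (2 / q * ln W - 2 / p * ln V) = W * (p * ln W - q * ln V)"
      by (simp only: mult.assoc)
    also have "\<dots> = q * ((ln W - ln V) * W) - W * ln W"
      unfolding q by (simp add: algebra_simps)
    finally show ?thesis unfolding lnn .
  qed
  show "(\<integral>x. \<bar>g x\<bar> ^ q \<partial>M) * (real p * real q / 2) * ln (Lq_norm_sq M q g / Lq_norm_sq M p g)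
      \<le> Ent M (\<lambda>x. \<bar>g x\<bar> ^ q)"
    using A B unfolding Ent_def W_def w_def by simp
qed

text \<open>A nonnegative series dominates each of its terms. At x = k this is k^k \<le> k!
  e^k.\<close>

lemma power_div_fact_le_exp:
  fixes x :: real
  assumes "x \<ge> 0"
  shows "x ^ k / fact k \<le> exp x"
proof -
  have "(\<Sum>n\<in>{k}. x ^ n / fact n) \<le> (\<Sum>n. x ^ n / fact n)"
    using assms summable_exp[of x] by (intro sum_le_suminf) (auto simp: field_simps)
  then show ?thesis by (simp add: exp_def divide_inverse mult.commute)
qed

subsection \<open>Disintegrations\<close>

text \<open>Holds for arbitrary \<open>k\<close> and \<open>f\<close>, since the degenerate values
  are harmless: a null total mass gives -\<infinity> and a non-measurable function gives
  \<infinity>, and \<open>real_of_ereal\<close> sends both to 0.\<close>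

lemma hI_nonneg: "hI k I f x \<ge> 0"
proof -
  let ?F = "\<lambda>(y, z). ereal \<bar>f (mrg I x y) - f (mrg I x z)\<bar>"
  have "real_of_ereal (esssup (k x \<Otimes>\<^sub>M k x) ?F) \<ge> 0"
  proof (cases "emeasure (k x \<Otimes>\<^sub>M k x) (space (k x \<Otimes>\<^sub>M k x)) = 0")
    case True
    show ?thesis
    proof (cases "?F \<in> borel_measurable (k x \<Otimes>\<^sub>M k x)")
      case meas: True
      have "AE p in k x \<Otimes>\<^sub>M k x. ?F p \<le> -\<infinity>" by (rule AE_I[OF _ True]) auto
      then have "esssup (k x \<Otimes>\<^sub>M k x) ?F \<le> -\<infinity>" by (rule esssup_I[OF meas])
      then have "esssup (k x \<Otimes>\<^sub>M k x) ?F = -\<infinity>" by (simp only: ereal_infty_less_eq2)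
      then show ?thesis by (simp only:) simp
    qed (simp add: esssup_non_measurable top_ereal_def)
  next
    case False
    then have "0 = esssup (k x \<Otimes>\<^sub>M k x) (\<lambda>_. 0 :: ereal)" by (simp add: esssup_const)
    also have "\<dots> \<le> esssup (k x \<Otimes>\<^sub>M k x) ?F" by (rule esssup_mono) auto
    finally show ?thesis by (rule real_of_ereal_pos)
  qed
  then show ?thesis unfolding hI_def by simp
qed

lemma hI_diff_const: "hI k I (\<lambda>x. f x - c) = hI k I f"
  by (simp add: hI_def fun_eq_iff)

lemma mrg_mrg [simp]: "mrg I (mrg I x y) z = mrg I x z"
  by (auto simp: mrg_def)

text \<open>A non-integrable function has Bochner integral 0, so \<open>partI\<close> can be bounded
  above through nonnegative integrals before any integrability is known.\<close>

lemma ennreal_integral_le_nn_integral: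
  fixes f :: "'b \<Rightarrow> real"
  assumes "\<And>x. f x \<ge> 0"
  shows "ennreal (\<integral>x. f x \<partial>M) \<le> (\<integral>\<^sup>+x. ennreal (f x) \<partial>M)"
proof (cases "integrable M f")
  case True
  then show ?thesis using assms by (simp add: nn_integral_eq_integral)
qed (simp add: not_integrable_integral_eq)

text \<open>Abstracts from the product structure: \<open>T\<close> carries the fibre coordinates,
  \<open>k_mrg\<close> says that the kernel is constant along fibres, and the disintegration
  identity is stated for sets only.\<close>

locale fibration = prob_space \<mu> for \<mu> :: "(nat \<Rightarrow> 'a) measure" +
  fixes I :: "nat set" and T :: "(nat \<Rightarrow> 'a) measure" and k :: "(nat \<Rightarrow> 'a) \<Rightarrow> (nat \<Rightarrow> 'a) measure"
  assumes mrg_measurable [measurable]: "(\<lambda>(x, y). mrg I x y) \<in> \<mu> \<Otimes>\<^sub>M T \<rightarrow>\<^sub>M \<mu>"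
    and k_measurable [measurable]: "k \<in> \<mu> \<rightarrow>\<^sub>M subprob_algebra T"
    and k_prob: "x \<in> space \<mu> \<Longrightarrow> prob_space (k x)"
    and k_mrg: "x \<in> space \<mu> \<Longrightarrow> y \<in> space T \<Longrightarrow> k (mrg I x y) = k x"
    and emeasure_disint: "A \<in> sets \<mu> \<Longrightarrow> emeasure \<mu> A = (\<integral>\<^sup>+x. emeasure (k x) {y \<in> space T. mrg I x y \<in> A} \<partial>\<mu>)"
begin

lemma sets_k [measurable_cong]: "x \<in> space \<mu> \<Longrightarrow> sets (k x) = sets T"
  and space_k: "x \<in> space \<mu> \<Longrightarrow> space (k x) = space T"
  using subprob_measurableD[OF k_measurable] by auto

lemma mrg_space: "x \<in> space \<mu> \<Longrightarrow> y \<in> space T \<Longrightarrow> mrg I x y \<in> space \<mu>"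
  using measurable_space[OF mrg_measurable, of "(x, y)"] by (simp add: space_pair_measure)

lemma mrg_measurable2 [measurable]: "x \<in> space \<mu> \<Longrightarrow> mrg I x \<in> T \<rightarrow>\<^sub>M \<mu>"
  using measurable_Pair2[OF mrg_measurable] by simp

text \<open>Invariance of \<mu> under resampling, phrased as a monadic identity so that the rules
  for integrals and null sets under \<open>bind\<close> apply.\<close>

lemma bind_distr_mrg: "\<mu> \<bind> (\<lambda>x. distr (k x) \<mu> (mrg I x)) = \<mu>"
  and distr_mrg_measurable: "(\<lambda>x. distr (k x) \<mu> (mrg I x)) \<in> \<mu> \<rightarrow>\<^sub>M subprob_algebra \<mu>"
proof -
  show m: "(\<lambda>x. distr (k x) \<mu> (mrg I x)) \<in> \<mu> \<rightarrow>\<^sub>M subprob_algebra \<mu>"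
    by (rule measurable_distr2[where M = T]) auto
  have s: "sets (\<mu> \<bind> (\<lambda>x. distr (k x) \<mu> (mrg I x))) = sets \<mu>"
    by (rule sets_bind) (auto simp: not_empty)
  show "\<mu> \<bind> (\<lambda>x. distr (k x) \<mu> (mrg I x)) = \<mu>"
  proof (rule measure_eqI[OF s])
    fix A assume "A \<in> sets (\<mu> \<bind> (\<lambda>x. distr (k x) \<mu> (mrg I x)))"
    then have A [measurable]: "A \<in> sets \<mu>" by (simp add: s)
    have "emeasure (\<mu> \<bind> (\<lambda>x. distr (k x) \<mu> (mrg I x))) A
        = (\<integral>\<^sup>+x. emeasure (distr (k x) \<mu> (mrg I x)) A \<partial>\<mu>)"
      by (rule emeasure_bind[OF _ m A]) (simp add: not_empty)
    also have "\<dots> = (\<integral>\<^sup>+x. emeasure (k x) {y \<in> space T. mrg I x y \<in> A} \<partial>\<mu>)"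
    proof (rule nn_integral_cong)
      fix x assume x: "x \<in> space \<mu>"
      have "mrg I x \<in> k x \<rightarrow>\<^sub>M \<mu>"
        using mrg_measurable2[OF x] measurable_cong_sets[OF sets_k[OF x] refl] by auto
      then have "emeasure (distr (k x) \<mu> (mrg I x)) A = emeasure (k x) (mrg I x -` A \<inter> space T)"
        using A by (simp add: emeasure_distr space_k[OF x])
      also have "mrg I x -` A \<inter> space T = {y \<in> space T. mrg I x y \<in> A}" by auto
      finally show "emeasure (distr (k x) \<mu> (mrg I x)) A = emeasure (k x) {y \<in> space T. mrg I x y \<in> A}" .
    qed
    finally show "emeasure (\<mu> \<bind> (\<lambda>x. distr (k x) \<mu> (mrg I x))) A = emeasure \<mu> A"
      by (simp add: emeasure_disint[OF A])
  qed
qed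

lemma mrg_measurable_k: "x \<in> space \<mu> \<Longrightarrow> mrg I x \<in> k x \<rightarrow>\<^sub>M \<mu>"
  using mrg_measurable2 measurable_cong_sets[OF sets_k refl] by auto

section \<open>Integrals and null sets along fibres\<close>

lemma nn_integral_disint:
  assumes g [measurable]: "g \<in> borel_measurable \<mu>"
  shows "(\<integral>\<^sup>+x. g x \<partial>\<mu>) = (\<integral>\<^sup>+x. \<integral>\<^sup>+y. g (mrg I x y) \<partial>k x \<partial>\<mu>)"
proof -
  have "(\<integral>\<^sup>+x. g x \<partial>\<mu>) = (\<integral>\<^sup>+x. \<integral>\<^sup>+y. g y \<partial>distr (k x) \<mu> (mrg I x) \<partial>\<mu>)"
    using nn_integral_bind[OF g distr_mrg_measurable] by (simp add: bind_distr_mrg)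
  also have "\<dots> = (\<integral>\<^sup>+x. \<integral>\<^sup>+y. g (mrg I x y) \<partial>k x \<partial>\<mu>)"
    by (intro nn_integral_cong nn_integral_distr mrg_measurable_k) auto
  finally show ?thesis .
qed

text \<open>\<open>P\<close> need not be measurable, so a measurable null set \<open>N\<close>
  covering its failures is transported by invariance under resampling.\<close>

lemma AE_disint:
  assumes "AE x in \<mu>. P x"
  shows "AE x in \<mu>. AE y in k x. P (mrg I x y)"
proof -
  obtain N where N: "{x \<in> space \<mu>. \<not> P x} \<subseteq> N" "emeasure \<mu> N = 0" and N' [measurable]: "N \<in> sets \<mu>"
    using assms by (rule AE_E)
  have "AE x in \<mu>. x \<notin> N"
    using N N' by (intro AE_not_in) (auto simp: null_sets_def)
  then have "AE x in \<mu> \<bind> (\<lambda>x. distr (k x) \<mu> (mrg I x)). x \<notin> N"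
    by (simp only: bind_distr_mrg)
  then have "AE x in \<mu>. AE y in distr (k x) \<mu> (mrg I x). y \<notin> N"
    by (subst (asm) AE_bind[OF distr_mrg_measurable]) auto
  then show ?thesis
  proof (rule AE_mp[OF _ AE_I2[OF impI]])
    fix x assume x: "x \<in> space \<mu>" and "AE y in distr (k x) \<mu> (mrg I x). y \<notin> N"
    then have "AE y in k x. mrg I x y \<notin> N"
      by (subst (asm) AE_distr_iff[OF mrg_measurable_k]) auto
    then show "AE y in k x. P (mrg I x y)"
      by (rule AE_mp[OF _ AE_I2[OF impI]]) (use N(1) mrg_space[OF x] in \<open>auto simp: space_k[OF x]\<close>)
  qed
qed

section \<open>Essential oscillation along a fibre\<close>

lemma measurable_difference [measurable]:
  assumes [measurable]: "f \<in> borel_measurable \<mu>"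
  shows "(\<lambda>(x, y, z). f (mrg I x y) - f (mrg I x z) :: real) \<in> borel_measurable (\<mu> \<Otimes>\<^sub>M (T \<Otimes>\<^sub>M T))"
  by measurable

lemma sets_pair_k: "x \<in> space \<mu> \<Longrightarrow> sets (k x \<Otimes>\<^sub>M k x) = sets (T \<Otimes>\<^sub>M T)"
  by (intro sets_pair_measure_cong sets_k)

lemma measurable_oscillation:
  assumes f: "f \<in> borel_measurable \<mu>" and x: "x \<in> space \<mu>"
  shows "(\<lambda>(y, z). ereal \<bar>f (mrg I x y) - f (mrg I x z)\<bar>) \<in> borel_measurable (k x \<Otimes>\<^sub>M k x)"
proof -
  have [measurable]: "f \<in> borel_measurable \<mu>" "mrg I x \<in> T \<rightarrow>\<^sub>M \<mu>" using f x by auto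
  have "(\<lambda>(y, z). ereal \<bar>f (mrg I x y) - f (mrg I x z)\<bar>) \<in> borel_measurable (T \<Otimes>\<^sub>M T)" by measurable
  then show ?thesis using measurable_cong_sets[OF sets_pair_k[OF x] refl] by blast
qed

text \<open>Fubini for null sets. It trades the product measure in \<open>hI\<close> for nested
  quantifiers over y and z, the form produced by \<open>AE_disint\<close>.\<close>

lemma AE_pair_k_iff:
  assumes f: "f \<in> borel_measurable \<mu>" and x: "x \<in> space \<mu>"
  shows "(AE p in k x \<Otimes>\<^sub>M k x. (case p of (y, z) \<Rightarrow> ereal \<bar>f (mrg I x y) - f (mrg I x z)\<bar>) \<le> c)
    \<longleftrightarrow> (AE y in k x. AE z in k x. ereal \<bar>f (mrg I x y) - f (mrg I x z)\<bar> \<le> c)"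
    (is "?L \<longleftrightarrow> ?R")
proof -
  interpret k: prob_space "k x" using x by (rule k_prob)
  interpret pair_prob_space "k x" "k x" ..
  note [measurable] = measurable_oscillation[OF f x]
  show ?thesis
  proof
    assume ?L then show ?R by (auto dest: AE_pair)
  next
    assume R: ?R
    show ?L by (rule AE_pair_measure) (use R in auto)
  qed
qed

lemma esssup_nonneg:
  assumes x: "x \<in> space \<mu>"
  shows "esssup (k x \<Otimes>\<^sub>M k x) (\<lambda>(y, z). ereal \<bar>f (mrg I x y) - f (mrg I x z)\<bar>) \<ge> 0"
proof -
  interpret k: prob_space "k x" using x by (rule k_prob)
  interpret pair_prob_space "k x" "k x" ..
  have "0 = esssup (k x \<Otimes>\<^sub>M k x) (\<lambda>_. 0 :: ereal)"
    by (rule esssup_const[symmetric]) (simp add: P.emeasure_space_1)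
  also have "\<dots> \<le> esssup (k x \<Otimes>\<^sub>M k x) (\<lambda>(y, z). ereal \<bar>f (mrg I x y) - f (mrg I x z)\<bar>)"
    by (rule esssup_mono) auto
  finally show ?thesis .
qed

lemma hI_le:
  assumes f: "f \<in> borel_measurable \<mu>" and x: "x \<in> space \<mu>"
    and ae: "AE y in k x. AE z in k x. \<bar>f (mrg I x y) - f (mrg I x z)\<bar> \<le> sqrt 2 * c"
  shows "hI k I f x \<le> c"
proof -
  let ?e = "esssup (k x \<Otimes>\<^sub>M k x) (\<lambda>(y, z). ereal \<bar>f (mrg I x y) - f (mrg I x z)\<bar>)"
  have "?e \<le> ereal (sqrt 2 * c)"
    using ae by (intro esssup_I measurable_oscillation[OF f x]) (simp add: AE_pair_k_iff[OF f x])
  then have "real_of_ereal ?e \<le> sqrt 2 * c"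
    using esssup_nonneg[OF x, of f] by (cases ?e) auto
  then show ?thesis unfolding hI_def by (simp add: field_simps)
qed

text \<open>The bound \<open>C\<close> keeps the essential supremum finite; an infinite one would be
  turned into 0 by \<open>real_of_ereal\<close> and the inequality would break down.\<close>

lemma AE_le_hI:
  assumes f: "f \<in> borel_measurable \<mu>" and x: "x \<in> space \<mu>"
    and ae: "AE y in k x. \<bar>f (mrg I x y)\<bar> \<le> C"
  shows "AE y in k x. AE z in k x. \<bar>f (mrg I x y) - f (mrg I x z)\<bar> \<le> sqrt 2 * hI k I f x"
proof -
  let ?F = "\<lambda>(y, z). ereal \<bar>f (mrg I x y) - f (mrg I x z)\<bar>"
  let ?e = "esssup (k x \<Otimes>\<^sub>M k x) ?F"
  have "AE y in k x. AE z in k x. ereal \<bar>f (mrg I x y) - f (mrg I x z)\<bar> \<le> ereal (2 * C)"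
    using ae
  proof eventually_elim
    case (elim y)
    from ae show ?case by eventually_elim (use elim in auto)
  qed
  then have "?e \<le> ereal (2 * C)"
    by (intro esssup_I measurable_oscillation[OF f x]) (simp add: AE_pair_k_iff[OF f x])
  then have "?e = ereal (sqrt 2 * hI k I f x)"
    using esssup_nonneg[OF x, of f] unfolding hI_def by (cases ?e) auto
  moreover have "AE p in k x \<Otimes>\<^sub>M k x. ?F p \<le> ?e" by (rule esssup_AE)
  ultimately have "AE y in k x. AE z in k x. ereal \<bar>f (mrg I x y) - f (mrg I x z)\<bar> \<le> ereal (sqrt 2 * hI k I f x)"
    by (simp add: AE_pair_k_iff[OF f x])
  then show ?thesis by simp
qed

text \<open>The essential supremum is at most c exactly when the set of pairs with oscillation above
  c is null. The mass of that set, a section of a measurable set, depends measurably on x because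
  the kernel does.\<close>

lemma hI_measurable [measurable]:
  assumes f [measurable]: "f \<in> borel_measurable \<mu>"
  shows "hI k I f \<in> borel_measurable \<mu>"
proof -
  let ?e = "\<lambda>x. esssup (k x \<Otimes>\<^sub>M k x) (\<lambda>(y, z). ereal \<bar>f (mrg I x y) - f (mrg I x z)\<bar>)"
  have "?e \<in> borel_measurable \<mu>"
  proof (rule borel_measurableI_le)
    fix c
    let ?A = "\<lambda>x. {(y, z) \<in> space (T \<Otimes>\<^sub>M T). c < ereal \<bar>f (mrg I x y) - f (mrg I x z)\<bar>}"
    have "?e x \<le> c \<longleftrightarrow> emeasure (k x \<Otimes>\<^sub>M k x) (?A x) = 0" if x: "x \<in> space \<mu>" for x
    proof -
      note [measurable] = measurable_oscillation[OF f x]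
      have sp: "space (k x \<Otimes>\<^sub>M k x) = space (T \<Otimes>\<^sub>M T)"
        by (rule sets_eq_imp_space_eq[OF sets_pair_k[OF x]])
      have "?e x \<le> c \<longleftrightarrow> (AE p in k x \<Otimes>\<^sub>M k x. (case p of (y, z) \<Rightarrow> ereal \<bar>f (mrg I x y) - f (mrg I x z)\<bar>) \<le> c)"
      proof
        assume le: "?e x \<le> c"
        have "AE p in k x \<Otimes>\<^sub>M k x. (case p of (y, z) \<Rightarrow> ereal \<bar>f (mrg I x y) - f (mrg I x z)\<bar>) \<le> ?e x"
          by (rule esssup_AE)
        then show "AE p in k x \<Otimes>\<^sub>M k x. (case p of (y, z) \<Rightarrow> ereal \<bar>f (mrg I x y) - f (mrg I x z)\<bar>) \<le> c"
          by eventually_elim (use le in \<open>auto intro: order_trans\<close>)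
      qed (rule esssup_I[OF measurable_oscillation[OF f x]])
      also have "\<dots> \<longleftrightarrow> emeasure (k x \<Otimes>\<^sub>M k x) {p \<in> space (k x \<Otimes>\<^sub>M k x). \<not> (case p of (y, z) \<Rightarrow> ereal \<bar>f (mrg I x y) - f (mrg I x z)\<bar>) \<le> c} = 0"
        by (rule AE_iff_measurable) auto
      also have "{p \<in> space (k x \<Otimes>\<^sub>M k x). \<not> (case p of (y, z) \<Rightarrow> ereal \<bar>f (mrg I x y) - f (mrg I x z)\<bar>) \<le> c} = ?A x"
        by (auto simp: sp)
      finally show ?thesis .
    qed
    then have "{x \<in> space \<mu>. ?e x \<le> c} = {x \<in> space \<mu>. emeasure (k x \<Otimes>\<^sub>M k x) (?A x) = 0}" by auto
    moreover have [measurable]: "(\<lambda>x. emeasure (k x \<Otimes>\<^sub>M k x) (?A x)) \<in> borel_measurable \<mu>"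
    proof (rule emeasure_measurable_subprob_algebra2[where N = "T \<Otimes>\<^sub>M T"])
      have "(SIGMA x:space \<mu>. ?A x) = {(x, y, z) \<in> space (\<mu> \<Otimes>\<^sub>M (T \<Otimes>\<^sub>M T)). c < ereal \<bar>f (mrg I x y) - f (mrg I x z)\<bar>}"
        by (auto simp: space_pair_measure)
      also have "\<dots> = {p \<in> space (\<mu> \<Otimes>\<^sub>M (T \<Otimes>\<^sub>M T)). c < ereal \<bar>case p of (x, y, z) \<Rightarrow> f (mrg I x y) - f (mrg I x z)\<bar>}"
        by auto
      also have "\<dots> \<in> sets (\<mu> \<Otimes>\<^sub>M (T \<Otimes>\<^sub>M T))"
        using measurable_difference[OF f] by measurable
      finally show "(SIGMA x:space \<mu>. ?A x) \<in> sets (\<mu> \<Otimes>\<^sub>M (T \<Otimes>\<^sub>M T))" .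
      show "(\<lambda>x. k x \<Otimes>\<^sub>M k x) \<in> \<mu> \<rightarrow>\<^sub>M subprob_algebra (T \<Otimes>\<^sub>M T)"
        by (rule measurable_pair_measure) auto
    qed
    ultimately show "{x \<in> space \<mu>. ?e x \<le> c} \<in> sets \<mu>" by simp
  qed
  then show ?thesis unfolding hI_def by measurable
qed

text \<open>\<open>hI\<close> sees x only through the kernel and the coordinates outside I. This
  allows \<open>hI\<close> to move in and out of fibre integrals.\<close>

lemma hI_mrg: "x \<in> space \<mu> \<Longrightarrow> y \<in> space T \<Longrightarrow> hI k I f (mrg I x y) = hI k I f x"
  by (simp add: hI_def k_mrg)

lemma AE_AE_le_hI:
  assumes f: "Linf \<mu> f"
  shows "AE x in \<mu>. AE y in k x. AE z in k x. \<bar>f (mrg I x y) - f (mrg I x z)\<bar> \<le> sqrt 2 * hI k I f x"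
proof -
  obtain C where "AE x in \<mu>. \<bar>f x\<bar> \<le> C" using f by (rule LinfE)
  then have "AE x in \<mu>. AE y in k x. \<bar>f (mrg I x y)\<bar> \<le> C" by (rule AE_disint)
  then show ?thesis
    by (rule AE_mp[OF _ AE_I2[OF impI]]) (rule AE_le_hI[OF Linf_measurable[OF f]])
qed

lemma Linf_hI:
  assumes f: "Linf \<mu> f"
  shows "Linf \<mu> (hI k I f)"
proof -
  have fm: "f \<in> borel_measurable \<mu>" using f by (simp add: Linf_def)
  obtain C where C: "AE x in \<mu>. \<bar>f x\<bar> \<le> C" using f by (rule LinfE)
  have "AE x in \<mu>. AE y in k x. \<bar>f (mrg I x y)\<bar> \<le> C" using C by (rule AE_disint)
  then have "AE x in \<mu>. \<bar>hI k I f x\<bar> \<le> 2 * C / sqrt 2"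
  proof (rule AE_mp[OF _ AE_I2[OF impI]])
    fix x assume x: "x \<in> space \<mu>" and ae: "AE y in k x. \<bar>f (mrg I x y)\<bar> \<le> C"
    have "AE y in k x. AE z in k x. \<bar>f (mrg I x y) - f (mrg I x z)\<bar> \<le> sqrt 2 * (2 * C / sqrt 2)"
      using ae
    proof eventually_elim
      case (elim y)
      from ae show ?case by eventually_elim (use elim in auto)
    qed
    then have "hI k I f x \<le> 2 * C / sqrt 2" by (rule hI_le[OF fm x])
    then show "\<bar>hI k I f x\<bar> \<le> 2 * C / sqrt 2" using hI_nonneg[of k I f x] by simp
  qed
  then show ?thesis using hI_measurable[OF fm] by (rule LinfI[rotated])
qed

section \<open>The discrete gradient of a power\<close>

lemma partI_measurable [measurable]:
  assumes u [measurable]: "u \<in> borel_measurable \<mu>"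
  shows "partI k I u \<in> borel_measurable \<mu>"
proof -
  have "(\<lambda>x. enn2real (\<integral>\<^sup>+y. ennreal ((u x - u (mrg I x y))\<^sup>2) \<partial>k x)) \<in> borel_measurable \<mu>"
    by (intro borel_measurable_enn2real nn_integral_measurable_subprob_algebra2[where N = T]) measurable
  \<comment> \<open>Both integrals agree even if infinite: \<open>enn2real\<close> and the Bochner
    integral then both return 0.\<close>
  then have "(\<lambda>x. \<integral>y. (u x - u (mrg I x y))\<^sup>2 \<partial>k x) \<in> borel_measurable \<mu>"
  proof (rule measurable_cong[THEN iffD1, rotated])
    fix x assume x: "x \<in> space \<mu>"
    have [measurable]: "mrg I x \<in> k x \<rightarrow>\<^sub>M \<mu>" using x by (rule mrg_measurable_k)
    show "enn2real (\<integral>\<^sup>+y. ennreal ((u x - u (mrg I x y))\<^sup>2) \<partial>k x) = (\<integral>y. (u x - u (mrg I x y))\<^sup>2 \<partial>k x)"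
      by (rule integral_eq_nn_integral[symmetric]) auto
  qed
  then show ?thesis unfolding partI_def by measurable
qed

text \<open>The base point x is itself resampled to z. Its kernel does not change, so z and y become
  independent draws from one fibre.\<close>

lemma nn_integral_partI_le:
  assumes u [measurable]: "u \<in> borel_measurable \<mu>"
  shows "(\<integral>\<^sup>+x. ennreal ((partI k I u x)\<^sup>2) \<partial>\<mu>)
    \<le> (\<integral>\<^sup>+x. \<integral>\<^sup>+z. \<integral>\<^sup>+y. ennreal (1/2 * (u (mrg I x z) - u (mrg I x y))\<^sup>2) \<partial>k x \<partial>k x \<partial>\<mu>)"
proof -
  let ?G = "\<lambda>x. \<integral>\<^sup>+y. ennreal (1/2 * (u x - u (mrg I x y))\<^sup>2) \<partial>k x"
  have [measurable]: "?G \<in> borel_measurable \<mu>"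
    by (intro nn_integral_measurable_subprob_algebra2[where N = T]) measurable
  have "(\<integral>\<^sup>+x. ennreal ((partI k I u x)\<^sup>2) \<partial>\<mu>) \<le> (\<integral>\<^sup>+x. ?G x \<partial>\<mu>)"
  proof (rule nn_integral_mono)
    fix x
    have eq: "(partI k I u x)\<^sup>2 = (\<integral>y. 1/2 * (u x - u (mrg I x y))\<^sup>2 \<partial>k x)"
      unfolding partI_def by (simp add: real_sqrt_pow2)
    show "ennreal ((partI k I u x)\<^sup>2) \<le> ?G x"
      unfolding eq by (rule ennreal_integral_le_nn_integral) simp
  qed
  also have "\<dots> = (\<integral>\<^sup>+x. \<integral>\<^sup>+z. ?G (mrg I x z) \<partial>k x \<partial>\<mu>)"
    by (rule nn_integral_disint) measurable
  also have "\<dots> = (\<integral>\<^sup>+x. \<integral>\<^sup>+z. \<integral>\<^sup>+y. ennreal (1/2 * (u (mrg I x z) - u (mrg I x y))\<^sup>2) \<partial>k x \<partial>k x \<partial>\<mu>)"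
    by (intro nn_integral_cong) (simp add: k_mrg space_k)
  finally show ?thesis .
qed

text \<open>The factor 1/2 in \<open>partI\<close> cancels the 2 coming from 1/sqrt 2 in
  \<open>hI\<close>, leaving q^2/4. The kernel has mass one, so the terms in z and in y integrate to
  the same value, which doubles the constant to q^2/2.\<close>

lemma nn_integral_partI_powr_le:
  assumes g: "Linf \<mu> g" and q: "q \<ge> (2::nat)"
  shows "(\<integral>\<^sup>+x. ennreal ((partI k I (\<lambda>x. \<bar>g x\<bar> powr (q/2)) x)\<^sup>2) \<partial>\<mu>)
    \<le> ennreal ((real q)\<^sup>2 / 2) * (\<integral>\<^sup>+x. ennreal (\<bar>g x\<bar> ^ (q - 2) * (hI k I g x)\<^sup>2) \<partial>\<mu>)"
proof -
  let ?u = "\<lambda>x. \<bar>g x\<bar> powr (q/2)"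
  have gm [measurable]: "g \<in> borel_measurable \<mu>" using g by (simp add: Linf_def)
  let ?c = "\<lambda>x. (real q)\<^sup>2 / 4 * (hI k I g x)\<^sup>2"
  let ?a = "\<lambda>x y. ennreal (\<bar>g (mrg I x y)\<bar> ^ (q - 2))"
  have "(\<integral>\<^sup>+x. ennreal ((partI k I ?u x)\<^sup>2) \<partial>\<mu>)
    \<le> (\<integral>\<^sup>+x. \<integral>\<^sup>+z. \<integral>\<^sup>+y. ennreal (1/2 * (?u (mrg I x z) - ?u (mrg I x y))\<^sup>2) \<partial>k x \<partial>k x \<partial>\<mu>)"
    by (rule nn_integral_partI_le) measurable
  also have "\<dots> \<le> (\<integral>\<^sup>+x. \<integral>\<^sup>+z. \<integral>\<^sup>+y. ennreal (?c x) * (?a x z + ?a x y) \<partial>k x \<partial>k x \<partial>\<mu>)"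
  proof (rule nn_integral_mono_AE, rule AE_mp[OF AE_AE_le_hI[OF g] AE_I2[OF impI]])
    fix x assume x: "x \<in> space \<mu>"
      and ae: "AE z in k x. AE y in k x. \<bar>g (mrg I x z) - g (mrg I x y)\<bar> \<le> sqrt 2 * hI k I g x"
    show "(\<integral>\<^sup>+z. \<integral>\<^sup>+y. ennreal (1/2 * (?u (mrg I x z) - ?u (mrg I x y))\<^sup>2) \<partial>k x \<partial>k x)
      \<le> (\<integral>\<^sup>+z. \<integral>\<^sup>+y. ennreal (?c x) * (?a x z + ?a x y) \<partial>k x \<partial>k x)"
    proof (rule nn_integral_mono_AE, rule AE_mp[OF ae AE_I2[OF impI]], rule nn_integral_mono_AE,
        erule AE_mp[OF _ AE_I2[OF impI]])
      fix y z
      assume le: "\<bar>g (mrg I x z) - g (mrg I x y)\<bar> \<le> sqrt 2 * hI k I g x"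
      let ?A = "\<bar>g (mrg I x z)\<bar>" and ?B = "\<bar>g (mrg I x y)\<bar>"
      have "\<bar>?A - ?B\<bar> \<le> sqrt 2 * hI k I g x" using le by linarith
      then have "(?A - ?B)\<^sup>2 \<le> (sqrt 2 * hI k I g x)\<^sup>2" by (rule abs_le_square_iff[THEN iffD1, OF order_trans]) simp
      then have d: "(?A - ?B)\<^sup>2 \<le> 2 * (hI k I g x)\<^sup>2" by (simp add: power_mult_distrib)
      have "(?A powr (q/2) - ?B powr (q/2))\<^sup>2 \<le> (real q)\<^sup>2 / 4 * (?A - ?B)\<^sup>2 * (?A ^ (q - 2) + ?B ^ (q - 2))"
        using q by (intro powr_half_diff_squared_le) auto
      also have "\<dots> \<le> (real q)\<^sup>2 / 4 * (2 * (hI k I g x)\<^sup>2) * (?A ^ (q - 2) + ?B ^ (q - 2))"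
        using d by (intro mult_right_mono mult_left_mono) auto
      finally have "1/2 * (?A powr (q/2) - ?B powr (q/2))\<^sup>2 \<le> ?c x * (?A ^ (q - 2) + ?B ^ (q - 2))"
        by simp
      then show "ennreal (1/2 * (?A powr (q/2) - ?B powr (q/2))\<^sup>2) \<le> ennreal (?c x) * (?a x z + ?a x y)"
        by (simp add: ennreal_mult[symmetric] ennreal_plus[symmetric] ennreal_leI del: ennreal_plus)
    qed
  qed
  also have "\<dots> = (\<integral>\<^sup>+x. \<integral>\<^sup>+z. ennreal ((real q)\<^sup>2 / 2) * ennreal ((hI k I g x)\<^sup>2 * \<bar>g (mrg I x z)\<bar> ^ (q - 2)) \<partial>k x \<partial>\<mu>)"
  proof (rule nn_integral_cong)
    fix x assume x: "x \<in> space \<mu>"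
    interpret k: prob_space "k x" using x by (rule k_prob)
    have [measurable]: "mrg I x \<in> k x \<rightarrow>\<^sub>M \<mu>" using x by (rule mrg_measurable_k)
    let ?J = "\<integral>\<^sup>+z. ?a x z \<partial>k x"
    have "(\<integral>\<^sup>+z. \<integral>\<^sup>+y. ennreal (?c x) * (?a x z + ?a x y) \<partial>k x \<partial>k x)
      = ennreal (?c x) * (?J + ?J)"
      by (simp add: nn_integral_cmult nn_integral_add k.emeasure_space_1)
    also have "\<dots> = ennreal (2 * ?c x) * ?J"
      by (simp add: distrib_left distrib_right[symmetric] ennreal_plus[symmetric] del: ennreal_plus)
    also have "\<dots> = (\<integral>\<^sup>+z. ennreal (2 * ?c x) * ?a x z \<partial>k x)"
      by (simp add: nn_integral_cmult)
    also have "\<dots> = (\<integral>\<^sup>+z. ennreal ((real q)\<^sup>2 / 2) * ennreal ((hI k I g x)\<^sup>2 * \<bar>g (mrg I x z)\<bar> ^ (q - 2)) \<partial>k x)"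
      by (intro nn_integral_cong) (simp add: ennreal_mult[symmetric] mult_ac)
    finally show "(\<integral>\<^sup>+z. \<integral>\<^sup>+y. ennreal (?c x) * (?a x z + ?a x y) \<partial>k x \<partial>k x)
      = (\<integral>\<^sup>+z. ennreal ((real q)\<^sup>2 / 2) * ennreal ((hI k I g x)\<^sup>2 * \<bar>g (mrg I x z)\<bar> ^ (q - 2)) \<partial>k x)" .
  qed
  also have "\<dots> = (\<integral>\<^sup>+x. \<integral>\<^sup>+z. ennreal ((real q)\<^sup>2 / 2) * ennreal (\<bar>g (mrg I x z)\<bar> ^ (q - 2) * (hI k I g (mrg I x z))\<^sup>2) \<partial>k x \<partial>\<mu>)"
    by (intro nn_integral_cong) (simp add: hI_mrg space_k mult.commute)
  also have "\<dots> = (\<integral>\<^sup>+x. ennreal ((real q)\<^sup>2 / 2) * ennreal (\<bar>g x\<bar> ^ (q - 2) * (hI k I g x)\<^sup>2) \<partial>\<mu>)"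
    by (rule nn_integral_disint[symmetric]) measurable
  also have "\<dots> = ennreal ((real q)\<^sup>2 / 2) * (\<integral>\<^sup>+x. ennreal (\<bar>g x\<bar> ^ (q - 2) * (hI k I g x)\<^sup>2) \<partial>\<mu>)"
    by (rule nn_integral_cmult) measurable
  finally show ?thesis .
qed

text \<open>Passes to Bochner integrals. Integrability, read off from the finite bound, is what lets
  the sum over \<I> be exchanged with the integral.\<close>

lemma
  assumes g: "Linf \<mu> g" and q: "q \<ge> (2::nat)"
  defines "u \<equiv> (\<lambda>x. \<bar>g x\<bar> powr (q/2))"
  shows integrable_partI_powr: "integrable \<mu> (\<lambda>x. (partI k I u x)\<^sup>2)"
    and integral_partI_powr_le: "(\<integral>x. (partI k I u x)\<^sup>2 \<partial>\<mu>)
      \<le> (real q)\<^sup>2 / 2 * (\<integral>x. \<bar>g x\<bar> ^ (q - 2) * (hI k I g x)\<^sup>2 \<partial>\<mu>)"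
proof -
  have gm [measurable]: "g \<in> borel_measurable \<mu>" using g by (simp add: Linf_def)
  have um [measurable]: "u \<in> borel_measurable \<mu>" unfolding u_def by measurable
  have int: "integrable \<mu> (\<lambda>x. \<bar>g x\<bar> ^ (q - 2) * (hI k I g x)\<^sup>2)"
    by (intro Linf_integrable Linf_mult Linf_power Linf_abs Linf_hI g)
  have le: "(\<integral>\<^sup>+x. ennreal ((partI k I u x)\<^sup>2) \<partial>\<mu>)
      \<le> ennreal ((real q)\<^sup>2 / 2 * (\<integral>x. \<bar>g x\<bar> ^ (q - 2) * (hI k I g x)\<^sup>2 \<partial>\<mu>))"
    using nn_integral_partI_powr_le[OF g q] int
    by (simp add: u_def nn_integral_eq_integral ennreal_mult[symmetric] integral_nonneg_AE)
  show "integrable \<mu> (\<lambda>x. (partI k I u x)\<^sup>2)"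
    by (rule integrableI_nonneg) (use le in \<open>auto simp: top.extremum_strict less_top intro: le_less_trans\<close>)
  then show "(\<integral>x. (partI k I u x)\<^sup>2 \<partial>\<mu>)
      \<le> (real q)\<^sup>2 / 2 * (\<integral>x. \<bar>g x\<bar> ^ (q - 2) * (hI k I g x)\<^sup>2 \<partial>\<mu>)"
    using le by (simp add: nn_integral_eq_integral ennreal_le_iff integral_nonneg_AE)
qed

end

subsection \<open>Moments under a logarithmic Sobolev inequality\<close>

text \<open>The first-order case of \<open>hnorm\<close>, as an operator of its own because it is
  also applied to the functions \<open>hnorm m \<I> j f\<close>; \<open>L2_set\<close> gives the
  triangle inequality.\<close>

definition hgrad :: "(nat set \<Rightarrow> (nat \<Rightarrow> 'a) \<Rightarrow> (nat \<Rightarrow> 'a) measure) \<Rightarrow> nat set set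
     \<Rightarrow> ((nat \<Rightarrow> 'a) \<Rightarrow> real) \<Rightarrow> (nat \<Rightarrow> 'a) \<Rightarrow> real" where
  "hgrad m \<I> f x = L2_set (\<lambda>I. hI (m I) I f x) \<I>"

lemma hgrad_diff_const: "hgrad m \<I> (\<lambda>x. f x - c) = hgrad m \<I> f"
  by (simp add: hgrad_def hI_diff_const fun_eq_iff)

lemma hnorm_eq_L2_set: "hnorm m \<I> j f x = L2_set (\<lambda>Is. hseq m Is f x) {Is. set Is \<subseteq> \<I> \<and> length Is = j}"
  by (simp add: hnorm_def L2_set_def)

lemma hnorm_nonneg [simp]: "hnorm m \<I> j f x \<ge> 0"
  by (simp add: hnorm_eq_L2_set)

lemma lists_Suc_length_eq:
  "{Is. set Is \<subseteq> A \<and> length Is = Suc j} = (\<lambda>(I, Is). I # Is) ` (A \<times> {Is. set Is \<subseteq> A \<and> length Is = j})"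
  by (auto simp: length_Suc_conv image_iff)

lemma hnorm_Suc:
  "hnorm m \<I> (Suc j) f x = sqrt (\<Sum>I\<in>\<I>. \<Sum>Is\<in>{Is. set Is \<subseteq> \<I> \<and> length Is = j}. (hI (m I) I (hseq m Is f) x)\<^sup>2)"
proof -
  have "inj_on (\<lambda>(I, Is). I # Is) (\<I> \<times> {Is. set Is \<subseteq> \<I> \<and> length Is = j})"
    by (auto simp: inj_on_def)
  then show ?thesis
    unfolding hnorm_def lists_Suc_length_eq
    by (simp add: sum.reindex case_prod_beta' sum.cartesian_product)
qed

lemma hnorm_1: "hnorm m \<I> (Suc 0) f = hgrad m \<I> f"
proof
  fix x
  have "{Is. set Is \<subseteq> \<I> \<and> length Is = 0} = {[]}" by auto
  then show "hnorm m \<I> (Suc 0) f x = hgrad m \<I> f x"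
    by (simp add: hnorm_Suc hgrad_def L2_set_def)
qed

lemma abs_L2_set_diff_le: "\<bar>L2_set f A - L2_set g A\<bar> \<le> L2_set (\<lambda>i. f i - g i) A"
proof -
  have "L2_set f A \<le> L2_set (\<lambda>i. f i - g i) A + L2_set g A"
    using L2_set_triangle_ineq[of "\<lambda>i. f i - g i" g A] by simp
  moreover have "L2_set g A \<le> L2_set (\<lambda>i. g i - f i) A + L2_set f A"
    using L2_set_triangle_ineq[of "\<lambda>i. g i - f i" f A] by simp
  moreover have "L2_set (\<lambda>i. g i - f i) A = L2_set (\<lambda>i. f i - g i) A"
    by (simp add: L2_set_def power2_commute)
  ultimately show ?thesis by linarith
qed

lemma Linf_L2_set:
  assumes "\<And>i. i \<in> A \<Longrightarrow> Linf M (\<lambda>x. f x i)"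
  shows "Linf M (\<lambda>x. L2_set (f x) A)"
proof (rule Linf_mono)
  show "Linf M (\<lambda>x. \<Sum>i\<in>A. \<bar>f x i\<bar>)" by (intro Linf_sum Linf_abs assms)
  have "(\<lambda>x. \<Sum>i\<in>A. (f x i)\<^sup>2) \<in> borel_measurable M"
    using assms by (intro borel_measurable_sum borel_measurable_power) (auto simp: Linf_def)
  then show "(\<lambda>x. L2_set (f x) A) \<in> borel_measurable M" unfolding L2_set_def by measurable
  show "AE x in M. \<bar>L2_set (f x) A\<bar> \<le> \<bar>\<Sum>i\<in>A. \<bar>f x i\<bar>\<bar>"
    using L2_set_le_sum_abs by (intro AE_I2) (simp add: sum_nonneg)
qed

locale lsi_space = prob_space \<mu> for \<mu> :: "(nat \<Rightarrow> 'a) measure" +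
  fixes \<I> :: "nat set set" and T :: "nat set \<Rightarrow> (nat \<Rightarrow> 'a) measure"
    and m :: "nat set \<Rightarrow> (nat \<Rightarrow> 'a) \<Rightarrow> (nat \<Rightarrow> 'a) measure" and sigma2 :: real
  assumes finite_I: "finite \<I>"
    and fib: "I \<in> \<I> \<Longrightarrow> fibration \<mu> I (T I) (m I)"
    and lsi: "LSI \<mu> m \<I> sigma2"
    and sigma_pos: "sigma2 > 0"
begin

section \<open>Moment recursion from the logarithmic Sobolev inequality\<close>

lemma Linf_hgrad:
  assumes f: "Linf \<mu> f"
  shows "Linf \<mu> (hgrad m \<I> f)"
  unfolding hgrad_def by (intro Linf_L2_set fibration.Linf_hI[OF fib] f)

lemma Linf_hseq:
  assumes f: "Linf \<mu> f"
  shows "set Is \<subseteq> \<I> \<Longrightarrow> Linf \<mu> (hseq m Is f)"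
  by (induction Is) (auto intro: f fibration.Linf_hI[OF fib])

lemma Linf_hnorm:
  assumes f: "Linf \<mu> f"
  shows "Linf \<mu> (hnorm m \<I> j f)"
  unfolding hnorm_eq_L2_set by (intro Linf_L2_set Linf_hseq f) auto

lemma Lq_norm_sq_Suc_le:
  assumes g: "Linf \<mu> g" and p: "p \<ge> 1" and q: "q = Suc p"
  shows "Lq_norm_sq \<mu> q g \<le> Lq_norm_sq \<mu> p g + 2 * sigma2 * (q / p) * Lq_norm_sq \<mu> q (hgrad m \<I> g)"
proof (cases "(\<integral>x. \<bar>g x\<bar> ^ q \<partial>\<mu>) = 0")
  case True
  then have "Lq_norm_sq \<mu> q g = 0" by (simp add: Lq_norm_sq_def)
  then show ?thesis using sigma_pos by simp
next
  case False
  define W where "W = (\<integral>x. \<bar>g x\<bar> ^ q \<partial>\<mu>)"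
  define A B N where "A = Lq_norm_sq \<mu> q g" and "B = Lq_norm_sq \<mu> p g" and "N = Lq_norm_sq \<mu> q (hgrad m \<I> g)"
  have "0 \<le> W" unfolding W_def by simp
  with False have W: "W > 0" unfolding W_def by linarith
  have A: "A > 0" using W by (simp add: A_def Lq_norm_sq_def W_def)
  have B: "B > 0" unfolding B_def using Ent_power_ge(1)[OF g p q] W by (simp add: W_def)
  have q2: "q \<ge> 2" using p q by simp
  define u where "u = (\<lambda>x. \<bar>g x\<bar> powr (q/2))"
  have u: "Linf \<mu> u" unfolding u_def by (intro Linf_powr g) simp
  have u2: "(u x)\<^sup>2 = \<bar>g x\<bar> ^ q" for x
    using q2 by (cases "g x = 0") (simp_all add: u_def powr_realpow[symmetric] powr_powr)
  have L: "Linf \<mu> (\<lambda>x. \<bar>g x\<bar> ^ (q - 2) * (hI (m I) I g x)\<^sup>2)" if "I \<in> \<I>" for I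
    using that by (intro Linf_mult Linf_power Linf_abs fibration.Linf_hI[OF fib] g)
  have "(\<integral>x. (grad_norm m \<I> u x)\<^sup>2 \<partial>\<mu>) = (\<integral>x. (\<Sum>I\<in>\<I>. (partI (m I) I u x)\<^sup>2) \<partial>\<mu>)"
    by (simp add: grad_norm_def sum_nonneg)
  also have "\<dots> = (\<Sum>I\<in>\<I>. \<integral>x. (partI (m I) I u x)\<^sup>2 \<partial>\<mu>)"
    unfolding u_def by (intro Bochner_Integration.integral_sum fibration.integrable_partI_powr[OF fib] g q2)
  also have "\<dots> \<le> (\<Sum>I\<in>\<I>. (real q)\<^sup>2 / 2 * (\<integral>x. \<bar>g x\<bar> ^ (q - 2) * (hI (m I) I g x)\<^sup>2 \<partial>\<mu>))"
    unfolding u_def by (intro sum_mono fibration.integral_partI_powr_le[OF fib] g q2)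
  also have "\<dots> = (real q)\<^sup>2 / 2 * (\<integral>x. (\<Sum>I\<in>\<I>. \<bar>g x\<bar> ^ (q - 2) * (hI (m I) I g x)\<^sup>2) \<partial>\<mu>)"
    using L by (subst Bochner_Integration.integral_sum) (auto simp: sum_distrib_left)
  also have "(\<integral>x. (\<Sum>I\<in>\<I>. \<bar>g x\<bar> ^ (q - 2) * (hI (m I) I g x)\<^sup>2) \<partial>\<mu>)
      = (\<integral>x. \<bar>g x\<bar> ^ (q - 2) * (hgrad m \<I> g x)\<^sup>2 \<partial>\<mu>)"
    by (simp add: hgrad_def L2_set_def sum_nonneg sum_distrib_left)
  also have "(real q)\<^sup>2 / 2 * \<dots> \<le> (real q)\<^sup>2 / 2 * (W / A * N)"
    unfolding W_def A_def N_def using W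
    by (intro mult_left_mono integral_power_mult_le Linf_hgrad g q2) (auto simp: W_def)
  finally have E: "(\<integral>x. (grad_norm m \<I> u x)\<^sup>2 \<partial>\<mu>) \<le> (real q)\<^sup>2 / 2 * (W / A * N)" .
  have "W * (real p * real q / 2) * ln (A / B) \<le> Ent \<mu> (\<lambda>x. \<bar>g x\<bar> ^ q)"
    unfolding W_def A_def B_def using W by (intro Ent_power_ge(2)[OF g p q]) (simp add: W_def)
  also have "\<dots> = Ent \<mu> (\<lambda>x. (u x)\<^sup>2)" by (simp only: u2)
  also have "\<dots> \<le> 2 * sigma2 * (\<integral>x. (grad_norm m \<I> u x)\<^sup>2 \<partial>\<mu>)"
    using lsi u by (simp add: LSI_def)
  also have "\<dots> \<le> 2 * sigma2 * ((real q)\<^sup>2 / 2 * (W / A * N))"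
    using E sigma_pos by (intro mult_left_mono) auto
  \<comment> \<open>Extracts the positive prefactor of the entropy bound, to be cancelled on both
    sides.\<close>
  also have "\<dots> = W * (real p * real q / 2) * (2 * sigma2 * (q / p) * (N / A))"
    using p by (simp add: power2_eq_square field_simps)
  finally have "ln (A / B) \<le> 2 * sigma2 * (q / p) * (N / A)"
    using W p q by (subst (asm) mult_le_cancel_left_pos) auto
  \<comment> \<open>Weakening the logarithm in this way makes the inequality linear: multiplying by
    A clears both denominators.\<close>
  moreover have "1 - B / A \<le> ln (A / B)"
    using ln_le_minus_one[of "B / A"] A B by (simp add: ln_div)
  ultimately have "1 - B / A \<le> 2 * sigma2 * (q / p) * (N / A)" by linarith
  then have "A * (1 - B / A) \<le> A * (2 * sigma2 * (q / p) * (N / A))"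
    using A by (intro mult_left_mono) auto
  moreover have "A * (1 - B / A) = A - B" using A by (simp add: right_diff_distrib)
  moreover have "A * (2 * sigma2 * (q / p) * (N / A)) = 2 * sigma2 * (q / p) * N" using A by simp
  ultimately show ?thesis by (simp add: A_def B_def N_def)
qed

lemma Lq_norm_sq_le:
  assumes g: "Linf \<mu> g" and Q: "Q \<ge> 2"
  shows "Lq_norm_sq \<mu> Q g \<le> Lq_norm_sq \<mu> 2 g + 3 * sigma2 * (real Q - 2) * Lq_norm_sq \<mu> Q (hgrad m \<I> g)"
proof -
  let ?N = "Lq_norm_sq \<mu> Q (hgrad m \<I> g)"
  have "Lq_norm_sq \<mu> p g \<le> Lq_norm_sq \<mu> 2 g + 3 * sigma2 * (real p - 2) * ?N" if "2 \<le> p" "p \<le> Q" for p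
    using that
  proof (induction p rule: dec_induct)
    case (step p)
    have "Lq_norm_sq \<mu> (Suc p) g \<le> Lq_norm_sq \<mu> p g + 2 * sigma2 * (Suc p / p) * Lq_norm_sq \<mu> (Suc p) (hgrad m \<I> g)"
      using step by (intro Lq_norm_sq_Suc_le g) auto
    also have "\<dots> \<le> Lq_norm_sq \<mu> p g + 2 * sigma2 * (3 / 2) * ?N"
    proof -
      \<comment> \<open>Each increment is charged at the top exponent Q, as norms increase with the
        exponent on a probability space, so all increments share one bound.\<close>
      have "Suc p / p \<le> 3 / 2" using step by (simp add: field_simps)
      moreover have "Lq_norm_sq \<mu> (Suc p) (hgrad m \<I> g) \<le> ?N"
        using step by (intro Lq_norm_sq_mono_exponent Linf_hgrad g) auto
      ultimately show ?thesis using sigma_pos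
        by (intro add_left_mono mult_mono mult_left_mono) auto
    qed
    also have "\<dots> \<le> Lq_norm_sq \<mu> 2 g + 3 * sigma2 * (real (Suc p) - 2) * ?N"
      using step by (simp add: algebra_simps)
    finally show ?case .
  qed simp
  then show ?thesis using Q by simp
qed

text \<open>The case \<open>p = 1\<close>, \<open>q = 2\<close> of the moment inequality becomes a Poincare inequality after
  adding a constant that makes the function nonnegative.\<close>

lemma variance_le:
  assumes f: "Linf \<mu> f"
  shows "Lq_norm_sq \<mu> 2 (\<lambda>x. f x - expectation f) \<le> 4 * sigma2 * Lq_norm_sq \<mu> 2 (hgrad m \<I> f)"
proof -
  obtain C where C: "AE x in \<mu>. \<bar>f x\<bar> \<le> C" using f by (rule LinfE)
  let ?g = "\<lambda>x. f x - (- C)"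
  have g: "Linf \<mu> ?g" by (intro Linf_diff f Linf_const)
  have "AE x in \<mu>. \<bar>?g x\<bar> = ?g x" using C by eventually_elim auto
  then have "(\<integral>x. \<bar>?g x\<bar> \<partial>\<mu>) = (\<integral>x. ?g x \<partial>\<mu>)"
    using g by (intro integral_cong_AE) (auto simp: Linf_def)
  also have "\<dots> = expectation f + C" using f by (simp add: Linf_integrable prob_space)
  finally have eq: "(\<integral>x. \<bar>?g x\<bar> \<partial>\<mu>) = expectation f + C" .
  have "0 \<le> (\<integral>x. \<bar>?g x\<bar> \<partial>\<mu>)" by simp
  \<comment> \<open>For a nonnegative function the squared L^1 norm is the squared mean, so the gap
    to the squared L^2 norm is the variance.\<close>
  then have 1: "Lq_norm_sq \<mu> 1 ?g = (expectation f + C)\<^sup>2"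
    unfolding Lq_norm_sq_def by (simp only: eq power_one_right) simp
  have i: "integrable \<mu> f" "integrable \<mu> (\<lambda>x. (f x)\<^sup>2)" using f by auto
  have 2: "Lq_norm_sq \<mu> 2 ?g = (\<integral>x. (f x)\<^sup>2 \<partial>\<mu>) + 2 * C * expectation f + C\<^sup>2"
    using i by (simp add: Lq_norm_sq_2 power2_sum prob_space)
  have 3: "Lq_norm_sq \<mu> 2 (\<lambda>x. f x - expectation f) = (\<integral>x. (f x)\<^sup>2 \<partial>\<mu>) - (expectation f)\<^sup>2"
    using i by (simp add: Lq_norm_sq_2 variance_eq)
  have "Lq_norm_sq \<mu> 2 ?g \<le> Lq_norm_sq \<mu> 1 ?g + 2 * sigma2 * (real 2 / real 1) * Lq_norm_sq \<mu> 2 (hgrad m \<I> ?g)"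
    by (rule Lq_norm_sq_Suc_le[OF g]) auto
  then show ?thesis unfolding 1 2 3 hgrad_diff_const by (simp add: power2_eq_square algebra_simps)
qed

text \<open>On a fibre the Euclidean norm oscillates at most by the norm of the coordinate
  differences. Each coordinate bound has its own null set; finiteness of \<I> makes the index lists
  finitely many, so the null sets merge at each of the levels x, y, z.\<close>

lemma hgrad_hnorm_le:
  assumes f: "Linf \<mu> f"
  shows "AE x in \<mu>. hgrad m \<I> (hnorm m \<I> j f) x \<le> hnorm m \<I> (Suc j) f x"
proof -
  let ?L = "{Is. set Is \<subseteq> \<I> \<and> length Is = j}"
  have fin: "finite ?L" using finite_I by (rule finite_lists_length_eq)
  let ?s = "\<lambda>I x. L2_set (\<lambda>Is. hI (m I) I (hseq m Is f) x) ?L"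
  have one: "AE x in \<mu>. hI (m I) I (hnorm m \<I> j f) x \<le> ?s I x" if I: "I \<in> \<I>" for I
  proof -
    interpret fibration \<mu> I "T I" "m I" using I by (rule fib)
    have "AE x in \<mu>. \<forall>Is\<in>?L. AE y in m I x. AE z in m I x.
        \<bar>hseq m Is f (mrg I x y) - hseq m Is f (mrg I x z)\<bar> \<le> sqrt 2 * hI (m I) I (hseq m Is f) x"
      by (intro AE_finite_allI fin AE_AE_le_hI Linf_hseq f) auto
    then show ?thesis
    proof (rule AE_mp[OF _ AE_I2[OF impI]])
      fix x assume x: "x \<in> space \<mu>"
        and "\<forall>Is\<in>?L. AE y in m I x. AE z in m I x.
          \<bar>hseq m Is f (mrg I x y) - hseq m Is f (mrg I x z)\<bar> \<le> sqrt 2 * hI (m I) I (hseq m Is f) x"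
      then have ae: "AE y in m I x. \<forall>Is\<in>?L. AE z in m I x.
          \<bar>hseq m Is f (mrg I x y) - hseq m Is f (mrg I x z)\<bar> \<le> sqrt 2 * hI (m I) I (hseq m Is f) x"
        using fin by (intro AE_finite_allI) auto
      show "hI (m I) I (hnorm m \<I> j f) x \<le> ?s I x"
      proof (rule hI_le[OF _ x])
        show "hnorm m \<I> j f \<in> borel_measurable \<mu>" using Linf_hnorm[OF f] by (simp add: Linf_def)
        from ae show "AE y in m I x. AE z in m I x.
            \<bar>hnorm m \<I> j f (mrg I x y) - hnorm m \<I> j f (mrg I x z)\<bar> \<le> sqrt 2 * ?s I x"
        proof eventually_elim
          case (elim y)
          then have "AE z in m I x. \<forall>Is\<in>?L.
              \<bar>hseq m Is f (mrg I x y) - hseq m Is f (mrg I x z)\<bar> \<le> sqrt 2 * hI (m I) I (hseq m Is f) x"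
            using fin by (intro AE_finite_allI) auto
          then show ?case
          proof eventually_elim
            case (elim z)
            have "\<bar>hnorm m \<I> j f (mrg I x y) - hnorm m \<I> j f (mrg I x z)\<bar>
                \<le> L2_set (\<lambda>Is. hseq m Is f (mrg I x y) - hseq m Is f (mrg I x z)) ?L"
              unfolding hnorm_eq_L2_set by (rule abs_L2_set_diff_le)
            also have "\<dots> = L2_set (\<lambda>Is. \<bar>hseq m Is f (mrg I x y) - hseq m Is f (mrg I x z)\<bar>) ?L"
              by (simp add: L2_set_def)
            also have "\<dots> \<le> L2_set (\<lambda>Is. sqrt 2 * hI (m I) I (hseq m Is f) x) ?L"
              using elim by (intro L2_set_mono) auto
            also have "\<dots> = sqrt 2 * ?s I x"
              by (simp add: L2_set_right_distrib)
            finally show ?case .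
          qed
        qed
      qed
    qed
  qed
  have "AE x in \<mu>. \<forall>I\<in>\<I>. hI (m I) I (hnorm m \<I> j f) x \<le> ?s I x"
    using one by (intro AE_finite_allI finite_I) auto
  then show ?thesis
  proof eventually_elim
    case (elim x)
    have "hgrad m \<I> (hnorm m \<I> j f) x \<le> L2_set (\<lambda>I. ?s I x) \<I>"
      unfolding hgrad_def using elim hI_nonneg by (intro L2_set_mono) auto
    also have "\<dots> = hnorm m \<I> (Suc j) f x"
      by (simp add: hnorm_Suc L2_set_def sum_nonneg)
    finally show ?case .
  qed
qed

section \<open>Moment growth for a function with controlled higher-order differences\<close>

context
  fixes f :: "(nat \<Rightarrow> 'a) \<Rightarrow> real" and d :: nat
  assumes f: "Linf \<mu> f" and d: "d \<ge> 1"
    and lower: "\<And>j. 1 \<le> j \<Longrightarrow> j < d \<Longrightarrow> Lq_norm_sq \<mu> 2 (hnorm m \<I> j f) \<le> sigma2 ^ (d - j)"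
    and top: "AE x in \<mu>. hnorm m \<I> d f x \<le> 1"
begin

text \<open>Descends from order d, i being the number of steps taken. With Y = 3Q-5 = 1 + 3(Q-2),
  one step yields 1 + (Y-1) Y^i, which is at most Y^(i+1) because Y \<ge> 1.\<close>

lemma Lq_norm_sq_hnorm_le:
  assumes Q: "Q \<ge> 2" and i: "i < d"
  shows "Lq_norm_sq \<mu> Q (hnorm m \<I> (d - i) f) \<le> sigma2 ^ i * (3 * real Q - 5) ^ i"
  using i
proof (induction i)
  case 0
  have "Lq_norm_sq \<mu> Q (hnorm m \<I> d f) \<le> Lq_norm_sq \<mu> Q (\<lambda>_. 1)"
    using top by (intro Lq_norm_sq_mono Linf_hnorm f) auto
  also have "\<dots> = 1" by (simp add: Lq_norm_sq_def prob_space)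
  finally show ?case by simp
next
  case (Suc i)
  define j where "j = d - Suc i"
  define Y where "Y = 3 * real Q - 5"
  have Y: "Y \<ge> 1" using Q by (simp add: Y_def)
  have j: "1 \<le> j" "j < d" "Suc j = d - i" "d - j = Suc i" using Suc by (auto simp: j_def)
  have "Lq_norm_sq \<mu> Q (hnorm m \<I> j f)
      \<le> Lq_norm_sq \<mu> 2 (hnorm m \<I> j f) + 3 * sigma2 * (real Q - 2) * Lq_norm_sq \<mu> Q (hgrad m \<I> (hnorm m \<I> j f))"
    by (rule Lq_norm_sq_le[OF Linf_hnorm[OF f] Q])
  also have "Lq_norm_sq \<mu> Q (hgrad m \<I> (hnorm m \<I> j f)) \<le> Lq_norm_sq \<mu> Q (hnorm m \<I> (Suc j) f)"
  proof (rule Lq_norm_sq_mono)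
    show "AE x in \<mu>. \<bar>hgrad m \<I> (hnorm m \<I> j f) x\<bar> \<le> \<bar>hnorm m \<I> (Suc j) f x\<bar>"
      using hgrad_hnorm_le[OF f, of j] by eventually_elim (simp add: hgrad_def)
  qed (intro Linf_hgrad Linf_hnorm f)+
  also have "\<dots> \<le> sigma2 ^ i * Y ^ i" using Suc j by (simp add: Y_def)
  finally have "Lq_norm_sq \<mu> Q (hnorm m \<I> j f)
      \<le> Lq_norm_sq \<mu> 2 (hnorm m \<I> j f) + 3 * sigma2 * (real Q - 2) * (sigma2 ^ i * Y ^ i)"
    using sigma_pos Q by (simp add: mult_left_mono)
  also have "\<dots> \<le> sigma2 ^ Suc i + 3 * sigma2 * (real Q - 2) * (sigma2 ^ i * Y ^ i)"
    using lower[OF j(1,2)] j by simp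
  also have "\<dots> = sigma2 ^ Suc i * (1 + (Y - 1) * Y ^ i)"
    by (simp add: Y_def algebra_simps)
  also have "\<dots> \<le> sigma2 ^ Suc i * Y ^ Suc i"
    using one_le_power[OF Y, of i] sigma_pos by (intro mult_left_mono) (auto simp: algebra_simps)
  finally show ?case by (simp add: j_def Y_def)
qed

lemma Lq_norm_sq_centered_le:
  assumes Q: "Q \<ge> 2"
  shows "Lq_norm_sq \<mu> Q (\<lambda>x. f x - expectation f) \<le> (3 * real Q * sigma2) ^ d"
proof -
  let ?g = "\<lambda>x. f x - expectation f"
  define Y where "Y = 3 * real Q - 5"
  have Y: "Y \<ge> 1" using Q by (simp add: Y_def)
  obtain e where e: "d = Suc e" using d by (cases d) auto
  have h1: "Lq_norm_sq \<mu> Q (hgrad m \<I> f) \<le> sigma2 ^ e * Y ^ e"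
    using Lq_norm_sq_hnorm_le[OF Q, of e] by (simp add: e Y_def hnorm_1)
  \<comment> \<open>At Q = 2 the factor 3Q-5 equals 1. For d = 1 this rests on \<open>top\<close>,
    for larger d also on \<open>lower\<close>.\<close>
  have h2: "Lq_norm_sq \<mu> 2 (hgrad m \<I> f) \<le> sigma2 ^ e"
    using Lq_norm_sq_hnorm_le[of 2 e] by (simp add: e hnorm_1)
  have "Lq_norm_sq \<mu> Q ?g \<le> Lq_norm_sq \<mu> 2 ?g + 3 * sigma2 * (real Q - 2) * Lq_norm_sq \<mu> Q (hgrad m \<I> f)"
    using Lq_norm_sq_le[OF Linf_diff[OF f Linf_const] Q] by (simp only: hgrad_diff_const)
  also have "\<dots> \<le> 4 * sigma2 * sigma2 ^ e + 3 * sigma2 * (real Q - 2) * (sigma2 ^ e * Y ^ e)"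
    using variance_le[OF f] h1 h2 sigma_pos Q
    by (intro add_mono order.trans[OF variance_le[OF f]] mult_left_mono) auto
  also have "\<dots> = sigma2 ^ d * (4 + (Y - 1) * Y ^ e)"
    by (simp add: e Y_def algebra_simps)
  \<comment> \<open>The 4 from the variance bound is split as 1 + 3 and multiplied by Y^e \<ge> 1;
    then Y + 3 = 3Q - 2 fits below 3Q.\<close>
  also have "\<dots> \<le> sigma2 ^ d * ((Y + 3) * Y ^ e)"
    using one_le_power[OF Y, of e] sigma_pos by (intro mult_left_mono) (auto simp: algebra_simps)
  also have "\<dots> \<le> sigma2 ^ d * (3 * real Q) ^ d"
    unfolding e power_Suc using Y sigma_pos
    by (intro mult_left_mono mult_mono power_mono) (auto simp: Y_def)
  finally show ?thesis by (simp add: power_mult_distrib mult.commute)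
qed

lemma moment_centered_le:
  assumes k: "k \<ge> 1"
  shows "(\<integral>x. (\<bar>f x - expectation f\<bar> powr (2 / d)) ^ k \<partial>\<mu>) \<le> (6 * sigma2 * k) ^ k"
proof -
  let ?g = "\<lambda>x. f x - expectation f"
  let ?B = "6 * sigma2 * real k"
  have B: "?B > 0" using k sigma_pos by simp
  have g: "Linf \<mu> ?g" using f by auto
  have "Lq_norm_sq \<mu> (2 * k) ?g \<le> ?B ^ d"
    using Lq_norm_sq_centered_le[of "2 * k"] k by (simp add: mult_ac)
  then have "Lq_norm_sq \<mu> (2 * k) ?g powr k \<le> (?B ^ d) powr k"
    by (intro powr_mono2) auto
  then have le: "(\<integral>x. \<bar>?g x\<bar> ^ (2 * k) \<partial>\<mu>) \<le> (?B ^ d) powr k"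
    using k by (simp add: Lq_norm_sq_def powr_powr)
  \<comment> \<open>The fractional moment becomes a 1/d-th power of an even one, where concavity
    applies.\<close>
  have "(\<bar>?g x\<bar> powr (2 / d)) ^ k = (\<bar>?g x\<bar> ^ (2 * k)) powr (1 / d)" for x
    using d k by (cases "?g x = 0") (simp_all add: powr_realpow[symmetric] powr_powr mult_ac zero_power)
  then have "(\<integral>x. (\<bar>?g x\<bar> powr (2 / d)) ^ k \<partial>\<mu>) = (\<integral>x. (\<bar>?g x\<bar> ^ (2 * k)) powr (1 / d) \<partial>\<mu>)"
    by simp
  also have "\<dots> \<le> (\<integral>x. \<bar>?g x\<bar> ^ (2 * k) \<partial>\<mu>) powr (1 / d)"
    using g d by (intro integral_powr_le) auto
  also have "\<dots> \<le> ((?B ^ d) powr k) powr (1 / d)"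
    using le by (intro powr_mono2) auto
  also have "\<dots> = ?B ^ k"
    using B d by (simp add: powr_realpow[symmetric] powr_powr)
  finally show ?thesis .
qed

end

end

subsection \<open>Exponential moments\<close>

text \<open>Nonnegative integrals permit termwise integration of the exponential series. At k = 0
  the moment bound reads \<open>0 ^ 0 = 1\<close> and limits the total mass.\<close>

lemma nn_integral_exp_le_2:
  fixes t :: "'b \<Rightarrow> real"
  assumes t [measurable]: "t \<in> borel_measurable M" and nonneg: "\<And>x. t x \<ge> 0" and a: "a > 0"
    and moments: "\<And>k. (\<integral>\<^sup>+x. ennreal (t x ^ k) \<partial>M) \<le> ennreal ((a * real k) ^ k)"
  shows "(\<integral>\<^sup>+x. ennreal (exp (t x / (2 * exp 1 * a))) \<partial>M) \<le> 2"
proof -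
  define c where "c = 1 / (2 * exp 1 * a)"
  have c: "c > 0" using a by (simp add: c_def)
  have "(\<integral>\<^sup>+x. ennreal (exp (t x / (2 * exp 1 * a))) \<partial>M) = (\<integral>\<^sup>+x. (\<Sum>k. ennreal ((c * t x) ^ k / fact k)) \<partial>M)"
  proof (rule nn_integral_cong)
    fix x
    have "(\<lambda>k. (c * t x) ^ k / fact k) sums exp (c * t x)"
      using exp_converges[of "c * t x"] by (simp add: divide_inverse mult.commute)
    then have "(\<Sum>k. ennreal ((c * t x) ^ k / fact k)) = ennreal (exp (c * t x))"
      using c nonneg[of x] by (intro suminf_ennreal_eq) auto
    then show "ennreal (exp (t x / (2 * exp 1 * a))) = (\<Sum>k. ennreal ((c * t x) ^ k / fact k))"
      by (simp add: c_def)
  qed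
  also have "\<dots> = (\<Sum>k. \<integral>\<^sup>+x. ennreal ((c * t x) ^ k / fact k) \<partial>M)"
    by (rule nn_integral_suminf) measurable
  also have "\<dots> \<le> (\<Sum>k. ennreal ((1 / 2) ^ k))"
  proof (intro suminf_le summableI)
    fix k
    have "(\<integral>\<^sup>+x. ennreal ((c * t x) ^ k / fact k) \<partial>M) = (\<integral>\<^sup>+x. ennreal (c ^ k / fact k) * ennreal (t x ^ k) \<partial>M)"
      using c nonneg by (intro nn_integral_cong) (simp add: ennreal_mult[symmetric] power_mult_distrib)
    also have "\<dots> = ennreal (c ^ k / fact k) * (\<integral>\<^sup>+x. ennreal (t x ^ k) \<partial>M)"
      by (rule nn_integral_cmult) measurable
    also have "\<dots> \<le> ennreal (c ^ k / fact k) * ennreal ((a * real k) ^ k)"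
      by (intro mult_left_mono moments) auto
    also have "\<dots> = ennreal (c ^ k / fact k * (a * real k) ^ k)"
      using c a by (intro ennreal_mult[symmetric]) auto
    \<comment> \<open>The choice of c cancels a; its e absorbs k^k/k! and its 2 gives the geometric
      decay.\<close>
    also have "c ^ k / fact k * (a * real k) ^ k = (1 / 2) ^ k * (real k ^ k / fact k / exp (real k))"
      using a by (simp add: c_def power_mult_distrib power_divide exp_of_nat_mult[symmetric] field_simps)
    also have "\<dots> \<le> (1 / 2) ^ k * 1"
      using power_div_fact_le_exp[of "real k" k] by (intro mult_left_mono) (auto simp: divide_le_eq mult.commute)
    finally show "(\<integral>\<^sup>+x. ennreal ((c * t x) ^ k / fact k) \<partial>M) \<le> ennreal ((1 / 2) ^ k)"
      by (simp add: ennreal_leI)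
  qed
  also have "\<dots> = ennreal 2"
    using geometric_sums[of "1 / 2 :: real"] by (intro suminf_ennreal_eq) auto
  finally show ?thesis by simp
qed

subsection \<open>Product spaces\<close>

text \<open>\<open>mrg\<close> alters only coordinates in I, so a kernel depending on the others is
  constant along fibres. Testing the integral identity on indicators gives the identity for
  sets.\<close>

lemma fibration_product:
  assumes prob: "prob_space \<mu>" and sets_mu: "sets \<mu> = sets (prodS n X)"
    and I: "I \<subseteq> {..<n}" and dis: "disintegration n X \<mu> I k"
  shows "fibration \<mu> I (prodSI I X) k"
proof -
  interpret prob_space \<mu> by (rule prob)
  have sp: "space \<mu> = space (prodS n X)" using sets_mu by (rule sets_eq_imp_space_eq)
  have mrg_sp: "mrg I x y \<in> space \<mu>" if "x \<in> space \<mu>" "y \<in> space (prodSI I X)" for x y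
    using that I unfolding sp prodS_def prodSI_def space_PiM
    by (auto simp: mrg_def PiE_iff extensional_def)
  have mrg: "(\<lambda>(x, y). mrg I x y) \<in> \<mu> \<Otimes>\<^sub>M prodSI I X \<rightarrow>\<^sub>M \<mu>"
  proof -
    have "(\<lambda>p i. (if i \<in> I then snd p i else fst p i)) \<in> prodS n X \<Otimes>\<^sub>M prodSI I X \<rightarrow>\<^sub>M prodS n X"
      unfolding prodS_def
    proof (rule measurable_PiM_single')
      fix i assume i: "i \<in> {..<n}"
      show "(\<lambda>p. if i \<in> I then snd p i else fst p i) \<in> PiM {..<n} (\<lambda>i. borel_of (X i)) \<Otimes>\<^sub>M prodSI I X \<rightarrow>\<^sub>M borel_of (X i)"
        using i unfolding prodSI_def by (cases "i \<in> I") auto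
    next
      show "(\<lambda>p i. if i \<in> I then snd p i else fst p i) \<in> space (PiM {..<n} (\<lambda>i. borel_of (X i)) \<Otimes>\<^sub>M prodSI I X)
          \<rightarrow> (\<Pi>\<^sub>E i\<in>{..<n}. space (borel_of (X i)))"
      proof
        fix p assume "p \<in> space (PiM {..<n} (\<lambda>i. borel_of (X i)) \<Otimes>\<^sub>M prodSI I X)"
        then have "mrg I (fst p) (snd p) \<in> space \<mu>"
          by (intro mrg_sp) (auto simp: space_pair_measure sp prodS_def)
        then show "(\<lambda>i. if i \<in> I then snd p i else fst p i) \<in> (\<Pi>\<^sub>E i\<in>{..<n}. space (borel_of (X i)))"
          by (simp add: mrg_def sp prodS_def space_PiM)
      qed
    qed
    also have "(\<lambda>p i. (if i \<in> I then snd p i else fst p i)) = (\<lambda>(x, y). mrg I x y)"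
      by (auto simp: mrg_def fun_eq_iff)
    finally show ?thesis
      using measurable_cong_sets[OF sets_pair_measure_cong[OF sets_mu refl] sets_mu] by blast
  qed
  have k: "k \<in> \<mu> \<rightarrow>\<^sub>M subprob_algebra (prodSI I X)"
    using dis measurable_cong_sets[OF sets_mu refl] unfolding disintegration_def by blast
  have k_prob: "prob_space (k x)" and k_sets: "sets (k x) = sets (prodSI I X)" if "x \<in> space \<mu>" for x
    using dis that unfolding disintegration_def sp by blast+
  show ?thesis
  proof (rule fibration.intro[OF prob], rule fibration_axioms.intro)
    show "(\<lambda>(x, y). mrg I x y) \<in> \<mu> \<Otimes>\<^sub>M prodSI I X \<rightarrow>\<^sub>M \<mu>" by (rule mrg)
    show "k \<in> \<mu> \<rightarrow>\<^sub>M subprob_algebra (prodSI I X)" by (rule k)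
    show "prob_space (k x)" if "x \<in> space \<mu>" for x using that by (rule k_prob)
    show "k (mrg I x y) = k x" if "x \<in> space \<mu>" "y \<in> space (prodSI I X)" for x y
    proof -
      have "\<forall>i\<in>{..<n} - I. mrg I x y i = x i" by (simp add: mrg_def)
      then show ?thesis
        using dis that mrg_sp[OF that] unfolding disintegration_def sp by blast
    qed
    fix A assume A [measurable]: "A \<in> sets \<mu>"
    let ?S = "\<lambda>x. {y \<in> space (prodSI I X). mrg I x y \<in> A}"
    have "(SIGMA x:space \<mu>. ?S x) = (\<lambda>(x, y). mrg I x y) -` A \<inter> space (\<mu> \<Otimes>\<^sub>M prodSI I X)"
      by (auto simp: space_pair_measure)
    also have "\<dots> \<in> sets (\<mu> \<Otimes>\<^sub>M prodSI I X)" using mrg A by (rule measurable_sets)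
    finally have "(\<lambda>x. measure (k x) (?S x)) \<in> borel_measurable \<mu>"
      using k by (rule measure_measurable_subprob_algebra2)
    then have int: "integrable \<mu> (\<lambda>x. measure (k x) (?S x))"
      by (rule integrable_const_bound[rotated, of _ 1])
         (intro AE_I2, simp add: prob_space.prob_le_1[OF k_prob])
    have eq: "(\<integral>y. indicator A (mrg I x y) \<partial>k x) = measure (k x) (?S x)" if x: "x \<in> space \<mu>" for x
    proof -
      have "space (k x) = space (prodSI I X)" using k_sets[OF x] by (rule sets_eq_imp_space_eq)
      then have "(\<integral>y. indicator A (mrg I x y) \<partial>k x) = (\<integral>y. indicator (?S x) y \<partial>k x)"
        by (intro Bochner_Integration.integral_cong) (auto simp: indicator_def)
      also have "\<dots> = measure (k x) (?S x)"
        using \<open>space (k x) = _\<close> by (simp add: Int_absorb2 subset_eq)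
      finally show ?thesis .
    qed
    have "integrable \<mu> (indicator A :: _ \<Rightarrow> real)"
      by (rule integrable_const_bound[of _ 1]) auto
    then have "(\<integral>x. indicator A x \<partial>\<mu>) = (\<integral>x. (\<integral>y. indicator A (mrg I x y) \<partial>k x) \<partial>\<mu> :: real)"
      using dis unfolding disintegration_def by blast
    also have "\<dots> = (\<integral>x. measure (k x) (?S x) \<partial>\<mu>)"
      by (intro Bochner_Integration.integral_cong refl eq)
    finally have "measure \<mu> A = (\<integral>x. measure (k x) (?S x) \<partial>\<mu>)"
      using sets.sets_into_space[OF A] by (simp add: Int_absorb2)
    then have "emeasure \<mu> A = (\<integral>\<^sup>+x. ennreal (measure (k x) (?S x)) \<partial>\<mu>)"
      using int by (simp add: emeasure_eq_measure nn_integral_eq_integral)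
    also have "\<dots> = (\<integral>\<^sup>+x. emeasure (k x) (?S x) \<partial>\<mu>)"
    proof (rule nn_integral_cong)
      fix x assume "x \<in> space \<mu>"
      then interpret k: prob_space "k x" by (rule k_prob)
      show "ennreal (measure (k x) (?S x)) = emeasure (k x) (?S x)"
        by (simp add: k.emeasure_eq_measure)
    qed
    finally show "emeasure \<mu> A = (\<integral>\<^sup>+x. emeasure (k x) (?S x) \<partial>\<mu>)" .
  qed
qed

theorem theorem1p5:
  fixes n d :: nat and X :: "nat \<Rightarrow> 'a topology" and \<mu> :: "(nat \<Rightarrow> 'a) measure"
    and \<I> :: "nat set set" and m :: "nat set \<Rightarrow> (nat \<Rightarrow> 'a) \<Rightarrow> (nat \<Rightarrow> 'a) measure"
    and sigma2 :: real and f :: "(nat \<Rightarrow> 'a) \<Rightarrow> real"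
  assumes Polish: "\<forall>i<n. Polish (X i)"
    and prob: "prob_space \<mu>" and sets_mu: "sets \<mu> = sets (prodS n X)"
    and I_sub: "\<I> \<subseteq> Pow {..<n}"
    and disint: "\<forall>I\<in>\<I>. disintegration n X \<mu> I (m I)"
    and d_pos: "d \<ge> 1"
    and sigma_pos: "sigma2 > 0"
    and lsi: "LSI \<mu> m \<I> sigma2"
    and f_Linf: "Linf \<mu> f"
    and h_k: "\<forall>k\<in>{1..<d}. (\<integral>\<^sup>+ x. ennreal ((hnorm m \<I> k f x)^2) \<partial>\<mu>)
                 \<le> ennreal ((min 1 (sqrt sigma2 ^ (d - k)))^2)"
    and h_d: "AE x in \<mu>. hnorm m \<I> d f x \<le> 1"
  shows "(\<integral>\<^sup>+ x. ennreal (exp ((1 / (12 * sigma2 * exp 1))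
             * \<bar>f x - (\<integral>y. f y \<partial>\<mu>)\<bar> powr (2 / real d))) \<partial>\<mu>) \<le> 2"
proof -
  interpret prob_space \<mu> by (rule prob)
  interpret lsi_space \<mu> \<I> "\<lambda>I. prodSI I X" m sigma2
  proof (rule lsi_space.intro[OF prob], rule lsi_space_axioms.intro)
    show "finite \<I>" using I_sub by (rule finite_subset) simp
    show "fibration \<mu> I (prodSI I X) (m I)" if "I \<in> \<I>" for I
      using that I_sub disint by (intro fibration_product[OF prob sets_mu]) auto
  qed (fact lsi sigma_pos)+
  let ?t = "\<lambda>x. \<bar>f x - expectation f\<bar> powr (2 / real d)"
  \<comment> \<open>Here sigma is \<open>sqrt sigma2\<close>, so squared norm bounds become powers
    of \<open>sigma2\<close>.\<close>
  have lower: "Lq_norm_sq \<mu> 2 (hnorm m \<I> j f) \<le> sigma2 ^ (d - j)" if "1 \<le> j" "j < d" for j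
  proof -
    have "integrable \<mu> (\<lambda>x. (hnorm m \<I> j f x)\<^sup>2)"
      by (intro Linf_integrable Linf_power Linf_hnorm f_Linf)
    then have "ennreal (Lq_norm_sq \<mu> 2 (hnorm m \<I> j f)) = (\<integral>\<^sup>+x. ennreal ((hnorm m \<I> j f x)\<^sup>2) \<partial>\<mu>)"
      by (simp add: nn_integral_eq_integral Lq_norm_sq_2)
    also have "\<dots> \<le> ennreal ((min 1 (sqrt sigma2 ^ (d - j)))\<^sup>2)"
      using h_k that by auto
    finally have "Lq_norm_sq \<mu> 2 (hnorm m \<I> j f) \<le> (min 1 (sqrt sigma2 ^ (d - j)))\<^sup>2"
      by (subst (asm) ennreal_le_iff) auto
    also have "\<dots> \<le> (sqrt sigma2 ^ (d - j))\<^sup>2"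
      using sigma_pos by (intro power_mono) auto
    also have "\<dots> = sigma2 ^ (d - j)"
      using sigma_pos by (simp add: power_mult[symmetric] mult.commute[of _ 2]) (simp add: power_mult)
    finally show ?thesis .
  qed
  have "Linf \<mu> ?t" by (intro Linf_powr Linf_diff f_Linf Linf_const) simp
  then have "Linf \<mu> (\<lambda>x. ?t x ^ k)" for k by (rule Linf_power)
  moreover have "(\<integral>x. ?t x ^ k \<partial>\<mu>) \<le> (6 * sigma2 * k) ^ k" for k
    using moment_centered_le[OF f_Linf d_pos lower h_d, of k] by (cases "k = 0") (auto simp: prob_space)
  ultimately have "(\<integral>\<^sup>+x. ennreal (?t x ^ k) \<partial>\<mu>) \<le> ennreal ((6 * sigma2 * k) ^ k)" for k
    by (simp add: nn_integral_eq_integral Linf_integrable ennreal_leI)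
  \<comment> \<open>Taking a = 6 sigma^2 gives the constant 1/(2 e a) = 1/(12 sigma^2 e).\<close>
  then have "(\<integral>\<^sup>+x. ennreal (exp (?t x / (2 * exp 1 * (6 * sigma2)))) \<partial>\<mu>) \<le> 2"
    using \<open>Linf \<mu> ?t\<close> sigma_pos by (intro nn_integral_exp_le_2) (auto simp: Linf_def)
  then show ?thesis by (simp add: mult_ac)
qed

end
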